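(* Let $1\le p<\infty$, $0<r<\infty$, $0<q\le\infty$, $\frac1s:=\left(\frac1r-\frac1p\right)_+$. Let $u,v,w\in\mathfrak M^+$ with $0<\int_t^\infty u<\infty$ for all $t>0$, and let $k$ be an Oinarov kernel with constant $D$. Let $C_{\mathcal T}\in[0,\infty]$ be the least constant such that $\|\mathcal Tf\|_{L^r_u}\le C_{\mathcal T}\|f\|_{L^p_v}$ for all $f\in\mathfrak M^+$, where $$(\mathcal Tf)(x)=\left(\int_0^x w(y)\left(\int_y^\infty k(z,y)f(z)\,dz\right)^q dy\right)^{1/q}\ (q<\infty),\qquad (\mathcal Tf)(x)=\operatorname*{ess\,sup}_{y\in(0,x)} w(y)\int_y^\infty k(z,y)f(z)\,dz\ (q=\infty).$$ If $q<\infty$, let $\mathcal A_0,\mathcal A_1\in[0,\infty]$ be the least constants such that for all $f\in\mathfrak M^+$ $$\left(\int_0^\infty u(x)\left(\int_0^x w\right)^{\frac rq}\left(\int_x^\infty k(z,x)f(z)\,dz\right)^r dx\right)^{\frac1r}\le \mathcal A_0\|f\|_{L^p_v},$$ $$\left(\int_0^\infty u(x)\left(\int_0^x [k(x,y)]^q w(y)\,dy\right)^{\frac rq}\left(\int_x^\infty f\right)^r dx\right)^{\frac1r}\le \mathcal A_1\|f\|_{L^p_v};$$ if $q=\infty$, let $\mathcal A_0,\mathcal A_1\in[0,\infty]$ be the least constants such that for all $f\in\mathfrak M^+$ $$\left(\int_0^\infty u(x)\left[\operatorname*{ess\,sup}_{y\in(0,x)}w(y)\right]^r\left(\int_x^\infty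 k(z,x)f(z)\,dz\right)^r dx\right)^{\frac1r}\le \mathcal A_0\|f\|_{L^p_v},$$ $$\left(\int_0^\infty u(x)\left[\operatorname*{ess\,sup}_{y\in(0,x)}w(y)k(x,y)\right]^r\left(\int_x^\infty f\right)^r dx\right)^{\frac1r}\le \mathcal A_1\|f\|_{L^p_v}.$$ Let $$\mathcal A_2:=\begin{cases}\displaystyle\sup_{t\in(0,\infty)}\left(\int_t^\infty u\right)^{\frac1r}\|\mathcal H_t\|_{L^p_v\to L^q_w},& p\le r,\\[2mm] \displaystyle\left(\int_0^\infty u(x)\left(\int_x^\infty u\right)^{\frac sp}\|\mathcal H_{\zeta^{-1}(x),\zeta(x)}\|^s_{L^p_v\to L^q_w}\,dx\right)^{\frac1s},& r<p.\end{cases}$$ Then $C_{\mathcal T}<\infty$ if and only if $\mathcal A_0$, $\mathcal A_1$ and $\mathcal A_2$ are all finite. Moreover, $C_{\mathcal T}\approx \mathcal A_0+\mathcal A_1+\mathcal A_2$, i.e. each side is bounded by the other times a positive constant depending only on $p,q,r,D$.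
   Context: $\mathfrak M$ is the set of measurable functions on $[0,\infty)$, $\mathfrak M^+\subset\mathfrak M$ the non-negative ones. For $0<p<\infty$, $v\in\mathfrak M^+$: $\|f\|_{L^p_v}:=\left(\int_0^\infty|f|^pv\right)^{1/p}$; for $p=\infty$: $\|f\|_{L^\infty_v}:=\operatorname{ess\,sup}_{x\ge0}v(x)|f(x)|$. For a positive operator $H$ on $\mathfrak M^+$, $\|H\|_{L^p_v\to L^q_w}\in[0,\infty]$ is the least $C$ with $\|Hf\|_{L^q_w}\le C\|f\|_{L^p_v}$ for all $f\in\mathfrak M^+$. Expressions $0\cdot\infty$, $\frac\infty\infty$, $\frac00$ are taken to be $0$. $(a)_+=\max(a,0)$ ($s$ is used only when $r<p$). Oinarov kernel with constant $D\ge1$: a Borel function $k(x,y)\ge0$ on $[0,\infty)^2$ with $k(x,y)=0$ if $x<y$ and $\frac1D(k(x,z)+k(z,y))\le k(x,y)\le D(k(x,z)+k(z,y))$ for all $x\ge z\ge y\ge0$. The functions $\zeta,\zeta^{-1}:[0,\infty)\to[0,\infty)$ are defined (with $\sup\varnothing=0$) by $$\zeta(x):=\sup\left\{y>0:\int_y^\infty u\ge\tfrac12\int_x^\infty u\right\},\qquad \zeta^{-1}(x):=\sup\left\{y>0:\int_y^\infty u\ge2\int_x^\infty u\right\}.$$ For $0\le c<d<\infty$ and $f\in\mathfrak M^+$: $$(\mathcal H_{c,d}f)(x):=\chi_{(c,d]}(x)\int_x^{\zeta(d)} k(z,x)f(z)\,dz,\qquad (\mathcal H_df)(x):=\chi_{(0,d]}(x)\int_x^\infty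 k(z,x)f(z)\,dz.$$ *)

theory Defs
  imports "HOL-Probability.Essential_Supremum"
begin

text \<open>
  Non-negative measurable functions on the half-line take values in \<open>[0,\<infinity>]\<close>, so that the positive
  operators below map \<open>Mplus\<close> to itself; arithmetic on \<^typ>\<open>ennreal\<close> provides the convention
  \<open>0 \<cdot> \<infinity> = 0\<close>. Values of the functions at negative arguments are irrelevant.
\<close>

definition Mplus :: "(real \<Rightarrow> ennreal) set" where
  "Mplus = borel_measurable (lebesgue_on {0..})"

text \<open>The power \<open>x\<^sup>a\<close> on \<open>[0,\<infinity>]\<close>, only to be used for \<open>a > 0\<close>; then \<open>0\<^sup>a = 0\<close> and \<open>\<infinity>\<^sup>a = \<infinity>\<close>.\<close>

definition epowr :: "ennreal \<Rightarrow> real \<Rightarrow> ennreal" (infixr "epowr" 80) where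
  "x epowr a = (if x = top then top else ennreal (enn2real x powr a))"

definition wnorm :: "ennreal \<Rightarrow> (real \<Rightarrow> ennreal) \<Rightarrow> (real \<Rightarrow> ennreal) \<Rightarrow> ennreal" where
  "wnorm p v f =
    (if p = top then esssup (lebesgue_on {0..}) (\<lambda>x. v x * f x)
     else (\<integral>\<^sup>+x\<in>{0..}. (f x epowr enn2real p * v x) \<partial>lebesgue) epowr (1 / enn2real p))"

text \<open>
  The least constant \<open>C \<in> [0,\<infinity>]\<close> with \<open>L f \<le> C \<cdot> \<parallel>f\<parallel>\<close> for all \<open>f\<close>, the norm being that of \<open>L\<^sup>p\<^sub>v\<close>.
  If no \<open>C\<close> satisfies this (which can happen even for \<open>C = \<infinity>\<close>, as \<open>\<infinity> \<cdot> 0 = 0\<close>), the value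
  is \<open>Inf {} = \<infinity>\<close>.
\<close>

definition least_const ::
  "ennreal \<Rightarrow> (real \<Rightarrow> ennreal) \<Rightarrow> ((real \<Rightarrow> ennreal) \<Rightarrow> ennreal) \<Rightarrow> ennreal" where
  "least_const p v L = Inf {C. \<forall>f\<in>Mplus. L f \<le> C * wnorm p v f}"

definition op_norm ::
  "ennreal \<Rightarrow> (real \<Rightarrow> ennreal) \<Rightarrow> ennreal \<Rightarrow> (real \<Rightarrow> ennreal) \<Rightarrow>
   ((real \<Rightarrow> ennreal) \<Rightarrow> real \<Rightarrow> ennreal) \<Rightarrow> ennreal" where
  "op_norm p v q w H = least_const p v (\<lambda>f. wnorm q w (H f))"

definition oinarov_kernel :: "real \<Rightarrow> (real \<Rightarrow> real \<Rightarrow> real) \<Rightarrow> bool" where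
  "oinarov_kernel D k \<longleftrightarrow>
     (\<lambda>(x, y). k x y) \<in> borel_measurable (restrict_space borel ({0..} \<times> {0..})) \<and>
     (\<forall>x\<ge>0. \<forall>y\<ge>0. 0 \<le> k x y) \<and>
     (\<forall>x\<ge>0. \<forall>y\<ge>0. x < y \<longrightarrow> k x y = 0) \<and>
     (\<forall>x y z. x \<ge> z \<and> z \<ge> y \<and> y \<ge> 0 \<longrightarrow>
        1 / D * (k x z + k z y) \<le> k x y \<and> k x y \<le> D * (k x z + k z y))"

definition tail :: "(real \<Rightarrow> ennreal) \<Rightarrow> real \<Rightarrow> ennreal" where
  "tail u t = (\<integral>\<^sup>+x\<in>{t..}. u x \<partial>lebesgue)"

text \<open>The supremum with \<open>sup \<emptyset> = 0\<close>; the library leaves \<open>Sup {}\<close> unspecified on the reals.\<close>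

definition sup0 :: "real set \<Rightarrow> real" where
  "sup0 S = (if S = {} then 0 else Sup S)"

definition zeta :: "(real \<Rightarrow> ennreal) \<Rightarrow> real \<Rightarrow> real" where
  "zeta u x = sup0 {y. y > 0 \<and> tail u y \<ge> tail u x / 2}"

text \<open>This is the paper's \<open>\<zeta>\<^sup>-\<^sup>1\<close>, which is defined directly and not as an inverse function of \<open>\<zeta>\<close>.\<close>

definition zeta_inv :: "(real \<Rightarrow> ennreal) \<Rightarrow> real \<Rightarrow> real" where
  "zeta_inv u x = sup0 {y. y > 0 \<and> tail u y \<ge> 2 * tail u x}"

definition H_op :: "(real \<Rightarrow> real \<Rightarrow> real) \<Rightarrow> (real \<Rightarrow> ennreal) \<Rightarrow> real \<Rightarrow> ennreal" where
  "H_op k f x = (\<integral>\<^sup>+z\<in>{x..}. (ennreal (k z x) * f z) \<partial>lebesgue)"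

definition H_block ::
  "(real \<Rightarrow> real \<Rightarrow> real) \<Rightarrow> (real \<Rightarrow> ennreal) \<Rightarrow> real \<Rightarrow> real \<Rightarrow> (real \<Rightarrow> ennreal) \<Rightarrow> real \<Rightarrow> ennreal"
where
  "H_block k u c d f x =
     indicator {c<..d} x * (\<integral>\<^sup>+z\<in>{x..zeta u d}. (ennreal (k z x) * f z) \<partial>lebesgue)"

definition H_cut ::
  "(real \<Rightarrow> real \<Rightarrow> real) \<Rightarrow> real \<Rightarrow> (real \<Rightarrow> ennreal) \<Rightarrow> real \<Rightarrow> ennreal" where
  "H_cut k d f x = indicator {0<..d} x * H_op k f x"

definition T_op ::
  "ennreal \<Rightarrow> (real \<Rightarrow> ennreal) \<Rightarrow> (real \<Rightarrow> real \<Rightarrow> real) \<Rightarrow> (real \<Rightarrow> ennreal) \<Rightarrow> real \<Rightarrow> ennreal" where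
  "T_op q w k f x =
    (if q = top then esssup (lebesgue_on {0<..<x}) (\<lambda>y. w y * H_op k f y)
     else (\<integral>\<^sup>+y\<in>{0..x}. (w y * H_op k f y epowr enn2real q) \<partial>lebesgue) epowr (1 / enn2real q))"

definition C_T ::
  "real \<Rightarrow> ennreal \<Rightarrow> real \<Rightarrow> (real \<Rightarrow> ennreal) \<Rightarrow> (real \<Rightarrow> ennreal) \<Rightarrow> (real \<Rightarrow> ennreal) \<Rightarrow>
   (real \<Rightarrow> real \<Rightarrow> real) \<Rightarrow> ennreal" where
  "C_T p q r u v w k = op_norm (ennreal p) v (ennreal r) u (T_op q w k)"

definition A0 ::
  "real \<Rightarrow> ennreal \<Rightarrow> real \<Rightarrow> (real \<Rightarrow> ennreal) \<Rightarrow> (real \<Rightarrow> ennreal) \<Rightarrow> (real \<Rightarrow> ennreal) \<Rightarrow>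
   (real \<Rightarrow> real \<Rightarrow> real) \<Rightarrow> ennreal" where
  "A0 p q r u v w k = least_const (ennreal p) v
    (\<lambda>f. if q = top
      then (\<integral>\<^sup>+x\<in>{0..}. (u x * esssup (lebesgue_on {0<..<x}) w epowr r * H_op k f x epowr r)
              \<partial>lebesgue) epowr (1 / r)
      else (\<integral>\<^sup>+x\<in>{0..}. (u x * (\<integral>\<^sup>+y\<in>{0..x}. w y \<partial>lebesgue) epowr (r / enn2real q)
              * H_op k f x epowr r) \<partial>lebesgue) epowr (1 / r))"

definition A1 ::
  "real \<Rightarrow> ennreal \<Rightarrow> real \<Rightarrow> (real \<Rightarrow> ennreal) \<Rightarrow> (real \<Rightarrow> ennreal) \<Rightarrow> (real \<Rightarrow> ennreal) \<Rightarrow>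
   (real \<Rightarrow> real \<Rightarrow> real) \<Rightarrow> ennreal" where
  "A1 p q r u v w k = least_const (ennreal p) v
    (\<lambda>f. if q = top
      then (\<integral>\<^sup>+x\<in>{0..}. (u x * esssup (lebesgue_on {0<..<x}) (\<lambda>y. w y * ennreal (k x y)) epowr r
              * (\<integral>\<^sup>+z\<in>{x..}. f z \<partial>lebesgue) epowr r) \<partial>lebesgue) epowr (1 / r)
      else (\<integral>\<^sup>+x\<in>{0..}. (u x *
              (\<integral>\<^sup>+y\<in>{0..x}. (ennreal (k x y) epowr enn2real q * w y) \<partial>lebesgue) epowr (r / enn2real q)
              * (\<integral>\<^sup>+z\<in>{x..}. f z \<partial>lebesgue) epowr r) \<partial>lebesgue) epowr (1 / r))"

text \<open>The exponent \<open>s\<close> with \<open>1/s = (1/r - 1/p)\<^sub>+\<close>; meaningful (and used) only for \<open>r < p\<close>.\<close>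

definition s_exp :: "real \<Rightarrow> real \<Rightarrow> real" where
  "s_exp p r = 1 / max (1 / r - 1 / p) 0"

definition A2 ::
  "real \<Rightarrow> ennreal \<Rightarrow> real \<Rightarrow> (real \<Rightarrow> ennreal) \<Rightarrow> (real \<Rightarrow> ennreal) \<Rightarrow> (real \<Rightarrow> ennreal) \<Rightarrow>
   (real \<Rightarrow> real \<Rightarrow> real) \<Rightarrow> ennreal" where
  "A2 p q r u v w k =
    (if p \<le> r
     then (SUP t\<in>{0<..}. tail u t epowr (1 / r) * op_norm (ennreal p) v q w (H_cut k t))
     else (\<integral>\<^sup>+x\<in>{0..}. (u x * tail u x epowr (s_exp p r / p)
             * op_norm (ennreal p) v q w (H_block k u (zeta_inv u x) (zeta u x)) epowr s_exp p r)
             \<partial>lebesgue) epowr (1 / s_exp p r))"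

end

theory Submission
  imports Defs
begin

text \<open>
  Choose points \<open>x\<^sub>j\<close> with \<open>tail u x\<^sub>j = L 2\<^sup>-\<^sup>j\<close>. By geometric decay, the norm
  of \<open>\<T> f\<close> is controlled by the norms of \<open>H f\<close> on the blocks \<open>(x\<^sub>j, x\<^sub>j\<^sub>+\<^sub>1]\<close>. On such a block split \<open>f\<close> at
  \<open>x\<^sub>j\<^sub>+\<^sub>2\<close>. For the far part, the Oinarov inequality \<open>k(z,y) \<le> D (k(z,t) + k(t,y))\<close>, applied at every
  \<open>t\<close> of the next block and integrated against \<open>u(t) dt\<close>, yields the terms belonging to \<open>A0\<close> and \<open>A1\<close>.
  The near part is a block operator with input supported in \<open>(x\<^sub>j, x\<^sub>j\<^sub>+\<^sub>2]\<close>, and the block norms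
  are summed by monotonicity of \<open>\<ell>\<^sup>p\<close>-norms if \<open>p \<le> r\<close> and by Hoelder's inequality if \<open>r < p\<close>.
  Conversely, \<open>A0\<close> and \<open>A1\<close> are bounded pointwise by monotonicity of \<open>k\<close> up to the factor \<open>D\<close>, and
  for \<open>A2\<close> one tests with a maximum of near-extremal functions for the blocks, weighted according to
  the equality case of Hoelder's inequality.
\<close>

section \<open>Powers and sums over the integers\<close>

text \<open>The functions \<open>zeta u\<close> and \<open>zeta_inv u\<close> vary continuously many
  ways with t, whereas sums need fixed blocks. For t in block j, halving or doubling the tail moves
  the level by about one step, so block j lies inside (\<open>zeta_inv u t\<close>,
  \<open>zeta u t\<close>], which in turn lies in (0, \<open>x (j + 2)\<close>]. This two-sided
  comparison passes between the integral in \<open>A2\<close> and sums over blocks. If u is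
  integrable, levels above its total mass give \<open>x j = 0\<close>, and the block starting at 0
  could carry arbitrarily little of its level; every estimate needs block masses comparable to
  levels with a constant free of u, and this dictates the choice of L. The exponents q and r may lie
  below 1, so only quasi-triangle inequalities with explicit constants are available. Two further
  obstacles: since 0 * \<infinity> = 0, functions of infinite norm have to be treated separately
  when a least constant is estimated; and the weight factor in \<open>A1\<close> is not shown to be
  measurable in t, so the integral of the sum of the two far terms is split through a measurable
  minorant.\<close>

lemma epowr_ennreal [simp]: "0 \<le> x \<Longrightarrow> ennreal x epowr a = ennreal (x powr a)"
  by (simp add: epowr_def)

lemma top_epowr [simp]: "top epowr a = top"
  by (simp add: epowr_def)

lemma zero_epowr [simp]: "0 epowr a = 0"
  by (simp add: epowr_def)

lemma one_epowr [simp]: "1 epowr a = 1"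
  by (simp add: epowr_def)

lemma epowr_one [simp]: "x epowr 1 = x"
  by (cases x) auto

lemma epowr_mono: "0 \<le> a \<Longrightarrow> x \<le> y \<Longrightarrow> x epowr a \<le> y epowr a"
  by (cases x; cases y) (auto simp: powr_mono2 top_unique)

lemma epowr_mult: "(x * y) epowr a = x epowr a * y epowr a"
proof (cases "x = 0 \<or> y = 0")
  case False
  then show ?thesis
    by (cases x; cases y)
       (auto simp: ennreal_top_mult ennreal_mult_top powr_mult simp flip: ennreal_mult)
qed auto

lemma epowr_epowr: "(x epowr a) epowr b = x epowr (a * b)"
  by (cases x) (auto simp: powr_powr)

lemma epowr_inverse: "a \<noteq> 0 \<Longrightarrow> (x epowr (1 / a)) epowr a = x" "a \<noteq> 0 \<Longrightarrow> (x epowr a) epowr (1 / a) = x"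
  by (simp_all add: epowr_epowr)

lemma epowr_add: "x epowr (a + b) = x epowr a * x epowr b"
  by (cases x) (auto simp: powr_add ennreal_mult')

lemma epowr_less_top_iff [simp]: "x epowr a < top \<longleftrightarrow> x < top"
  by (cases x) auto

lemma epowr_eq_0_iff [simp]: "x epowr a = 0 \<longleftrightarrow> x = 0"
  by (cases x) auto

lemma epowr_le_iff: "0 < a \<Longrightarrow> x epowr a \<le> y epowr a \<longleftrightarrow> x \<le> y"
  by (metis epowr_mono epowr_inverse(2) less_imp_le zero_le_divide_1_iff not_less order_less_irrefl)

lemma epowr_le_swap: "0 < a \<Longrightarrow> x epowr a \<le> y \<longleftrightarrow> x \<le> y epowr (1 / a)"
  using epowr_le_iff[of a x "y epowr (1/a)"] by (simp add: epowr_inverse)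

lemma epowr_measurable [measurable]: "(\<lambda>x. x epowr a) \<in> borel_measurable borel"
  unfolding epowr_def by measurable

lemma epowr_max: "0 \<le> a \<Longrightarrow> (max x y) epowr a = max (x epowr a) (y epowr a)"
  by (metis epowr_mono max.absorb1 max.absorb2 linear)

lemma epowr_add_le:
  assumes "0 \<le> a"
  shows "(x + y) epowr a \<le> ennreal (2 powr a) * (x epowr a + y epowr a)"
proof -
  have "(x + y) epowr a \<le> (2 * max x y) epowr a"
    by (intro epowr_mono assms) (metis add_mono max.cobounded1 max.cobounded2 mult_2)
  also have "\<dots> = ennreal (2 powr a) * max (x epowr a) (y epowr a)"
    using assms epowr_ennreal[of 2 a] by (simp add: epowr_mult epowr_max)
  also have "\<dots> \<le> ennreal (2 powr a) * (x epowr a + y epowr a)"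
    by (intro mult_left_mono) auto
  finally show ?thesis .
qed

text \<open>One of the two powers always dominates alone: if y is at most x^(a-1), then x y is at
  most x^a; otherwise x is at most y^(b-1). Infinite values are covered by the same
  argument.\<close>

lemma epowr_young:
  assumes "1 < a" "1 < b" "1 / a + 1 / b = 1"
  shows "x * y \<le> x epowr a + y epowr b"
proof -
  have 1: "a - 1 = a / b" "b - 1 = b / a" using assms by (auto simp: field_simps)
  show ?thesis
  proof (cases "y \<le> x epowr (a - 1)")
    case True
    then have "x * y \<le> x epowr 1 * x epowr (a - 1)"
      by (auto intro: mult_left_mono)
    also have "\<dots> = x epowr a" by (subst epowr_add[symmetric]) simp
    finally show ?thesis by (simp add: add_increasing2)
  next
    case False
    then have "x epowr (a / b) \<le> y" by (simp add: 1)
    then have "x \<le> y epowr (b / a)"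
      using epowr_le_swap[of "a / b" x y] assms by simp
    then have "x * y \<le> y epowr (b - 1) * y epowr 1"
      by (auto intro: mult_right_mono simp: 1)
    also have "\<dots> = y epowr b" by (subst epowr_add[symmetric]) simp
    finally show ?thesis by (simp add: add_increasing)
  qed
qed

text \<open>The factor 2 spares the sharp form of Young's inequality.\<close>

lemma nn_integral_holder:
  assumes ab: "1 < a" "1 < b" "1 / a + 1 / b = 1"
  assumes [measurable]: "f \<in> borel_measurable M" "g \<in> borel_measurable M"
  shows "(\<integral>\<^sup>+x. f x * g x \<partial>M) \<le>
    2 * ((\<integral>\<^sup>+x. f x epowr a \<partial>M) epowr (1 / a) * (\<integral>\<^sup>+x. g x epowr b \<partial>M) epowr (1 / b))"
proof -
  define X where "X = (\<integral>\<^sup>+x. f x epowr a \<partial>M)"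
  define Y where "Y = (\<integral>\<^sup>+x. g x epowr b \<partial>M)"
  consider "X = 0" | "Y = 0" | "X \<noteq> 0" "Y \<noteq> 0" "X = top \<or> Y = top" | "X \<noteq> 0" "Y \<noteq> 0" "X \<noteq> top" "Y \<noteq> top"
    by blast
  then have "(\<integral>\<^sup>+x. f x * g x \<partial>M) \<le> 2 * (X epowr (1 / a) * Y epowr (1 / b))"
  proof cases
    case 1
    then have "AE x in M. f x = 0" by (simp add: X_def nn_integral_0_iff_AE)
    then have "(\<integral>\<^sup>+x. f x * g x \<partial>M) = 0" by (subst nn_integral_0_iff_AE) auto
    then show ?thesis by simp
  next
    case 2
    then have "AE x in M. g x = 0" by (simp add: Y_def nn_integral_0_iff_AE)
    then have "(\<integral>\<^sup>+x. f x * g x \<partial>M) = 0" by (subst nn_integral_0_iff_AE) auto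
    then show ?thesis by simp
  next
    case 3
    then show ?thesis by (auto simp: ennreal_top_mult ennreal_mult_top ennreal_mult_eq_top_iff)
  next
    case 4
    define x where "x = enn2real (X epowr (1 / a))"
    define y where "y = enn2real (Y epowr (1 / b))"
    have x: "ennreal x = X epowr (1 / a)" "0 < x"
      using 4 by (auto simp: x_def less_top enn2real_positive_iff zero_less_iff_neq_zero)
    have y: "ennreal y = Y epowr (1 / b)" "0 < y"
      using 4 by (auto simp: y_def less_top enn2real_positive_iff zero_less_iff_neq_zero)
    have "(\<integral>\<^sup>+z. (ennreal (1 / x) * f z) epowr a \<partial>M) = (ennreal (1 / x) * ennreal x) epowr a"
      using ab by (simp add: epowr_mult nn_integral_cmult X_def[symmetric] x epowr_inverse)
    moreover have "ennreal (1 / x) * ennreal x = 1"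
      using x(2) by (simp flip: ennreal_mult)
    ultimately have 5: "(\<integral>\<^sup>+z. (ennreal (1 / x) * f z) epowr a \<partial>M) = 1"
      by simp
    have "(\<integral>\<^sup>+z. (ennreal (1 / y) * g z) epowr b \<partial>M) = (ennreal (1 / y) * ennreal y) epowr b"
      using ab by (simp add: epowr_mult nn_integral_cmult Y_def[symmetric] y epowr_inverse)
    moreover have "ennreal (1 / y) * ennreal y = 1"
      using y(2) by (simp flip: ennreal_mult)
    ultimately have 6: "(\<integral>\<^sup>+z. (ennreal (1 / y) * g z) epowr b \<partial>M) = 1"
      by simp
    have 7: "f z * g z = ennreal (x * y) * ((ennreal (1 / x) * f z) * (ennreal (1 / y) * g z))" for z
    proof -
      have "ennreal (x * y) * (ennreal (1 / x) * ennreal (1 / y)) = 1"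
        using x y by (simp flip: ennreal_mult)
      then show ?thesis by (metis mult.assoc mult.commute mult.left_commute mult_1)
    qed
    have "(\<integral>\<^sup>+z. f z * g z \<partial>M) = ennreal (x * y) * (\<integral>\<^sup>+z. (ennreal (1 / x) * f z) * (ennreal (1 / y) * g z) \<partial>M)"
      by (subst 7) (simp add: nn_integral_cmult)
    also have "\<dots> \<le> ennreal (x * y) * (\<integral>\<^sup>+z. (ennreal (1 / x) * f z) epowr a + (ennreal (1 / y) * g z) epowr b \<partial>M)"
      by (intro mult_left_mono nn_integral_mono epowr_young ab) auto
    also have "\<dots> = ennreal (x * y) * 2"
      by (subst nn_integral_add) (auto simp: 5 6)
    finally show ?thesis using x y by (simp add: ennreal_mult mult.commute)
  qed
  then show ?thesis by (simp add: X_def Y_def)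
qed

text \<open>As integrals against counting measure, sums over the integers inherit interchange with
  other integrals, reindexing by bijections and Hoelder's inequality, all in [0,\<infinity>] and
  without summability conditions.\<close>

abbreviation int_sum :: "(int \<Rightarrow> ennreal) \<Rightarrow> ennreal" where
  "int_sum f \<equiv> (\<integral>\<^sup>+k. f k \<partial>count_space UNIV)"

lemma int_sum_upper: "f k \<le> int_sum f"
  by (rule nn_integral_ge_point) simp

text \<open>Exhaustion by the intervals from -n to n and monotone convergence. It lets
  \<open>finite_block_sum_le\<close> work with finite index sets, where the sum to be absorbed is
  known to be finite.\<close>

lemma int_sum_least:
  assumes "\<And>S. finite S \<Longrightarrow> sum f S \<le> B"
  shows "int_sum f \<le> B"
proof -
  have "f k = (SUP n::nat. f k * indicator {- int n..int n} k)" for k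
  proof (rule antisym)
    have "f k = f k * indicator {- int (nat \<bar>k\<bar>)..int (nat \<bar>k\<bar>)} k"
      by (auto simp: indicator_def)
    then show "f k \<le> (SUP n::nat. f k * indicator {- int n..int n} k)"
      by (metis (no_types, lifting) SUP_upper UNIV_I)
  qed (auto intro!: SUP_least split: split_indicator)
  then have "int_sum f = (\<integral>\<^sup>+k. (SUP n::nat. f k * indicator {- int n..int n} k) \<partial>count_space UNIV)"
    by (intro nn_integral_cong) simp
  also have "\<dots> = (SUP n::nat. \<integral>\<^sup>+k. f k * indicator {- int n..int n} k \<partial>count_space UNIV)"
    by (rule nn_integral_monotone_convergence_SUP) (auto simp: incseq_def le_fun_def split: split_indicator)
  also have "\<dots> \<le> B"
  proof (rule SUP_least)
    fix n :: nat
    have "(\<integral>\<^sup>+k. f k * indicator {- int n..int n} k \<partial>count_space UNIV) = sum f {- int n..int n}"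
      by (simp add: nn_integral_count_space_indicator[symmetric] nn_integral_count_space_finite)
    then show "(\<integral>\<^sup>+k. f k * indicator {- int n..int n} k \<partial>count_space UNIV) \<le> B"
      using assms by simp
  qed
  finally show ?thesis .
qed

lemma int_sum_shift: "int_sum (\<lambda>k. f (k + j)) = int_sum f"
  by (rule nn_integral_bij_count_space) (rule bij_betwI[where g="\<lambda>k. k - j"]; auto)

lemma int_sum_reflect: "int_sum (\<lambda>k. f (j - k)) = int_sum f"
  by (rule nn_integral_bij_count_space) (rule bij_betwI[where g="\<lambda>k. j - k"]; auto)

lemma int_sum_swap: "int_sum (\<lambda>k. int_sum (\<lambda>j. f k j)) = int_sum (\<lambda>j. int_sum (\<lambda>k. f k j))"
  by (rule nn_integral_count_space_nn_integral) auto

text \<open>The geometric series of ratio 2^(-a), extended by zeros to all integers so that shifts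
  and reflections of the index apply to it.\<close>

definition geom :: "real \<Rightarrow> ennreal" where
  "geom a = int_sum (\<lambda>n. if 0 \<le> n then ennreal (2 powr (- a * real_of_int n)) else 0)"

lemma geom_less_top:
  assumes "0 < a"
  shows "geom a < top"
proof -
  have "geom a = (\<integral>\<^sup>+n. ennreal (2 powr (- a * real_of_int n)) \<partial>count_space {0::int..})"
    unfolding geom_def
    by (subst nn_integral_count_space_indicator) (auto intro!: nn_integral_cong split: split_indicator)
  also have "\<dots> = (\<integral>\<^sup>+n. ennreal (2 powr (- a * real_of_int (int n))) \<partial>count_space UNIV)"
    by (rule nn_integral_bij_count_space[symmetric]) (rule bij_betwI[where g=nat]; auto)
  also have "\<dots> = (\<Sum>n. ennreal ((2 powr - a) ^ n))"
    by (simp add: nn_integral_count_space_nat powr_powr flip: powr_realpow)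
  also have "\<dots> < top"
  proof -
    have "summable (\<lambda>n. (2 powr - a) ^ n)"
      using assms by (intro summable_geometric) (simp add: powr_less_one)
    then show ?thesis by (subst suminf_ennreal2) auto
  qed
  finally show ?thesis .
qed

text \<open>Together with the next lemma: the kernel 2^(-a (k - j)) on j \<le> k has the same sum in
  either index. Sums over j bound the truncated norm by blocks, sums over k the outer
  integral.\<close>

lemma int_sum_geom_ge:
  "int_sum (\<lambda>k. if j \<le> k then ennreal (2 powr (- a * real_of_int (k - j))) else 0) = geom a"
  using int_sum_shift[of "\<lambda>n. if 0 \<le> n then ennreal (2 powr (- a * real_of_int n)) else 0" "- j"]
  unfolding geom_def by (simp add: algebra_simps cong: if_cong)

lemma int_sum_geom_le:
  "int_sum (\<lambda>j. if j \<le> k then ennreal (2 powr (- a * real_of_int (k - j))) else 0) = geom a"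
  using int_sum_reflect[of "\<lambda>n. if 0 \<le> n then ennreal (2 powr (- a * real_of_int n)) else 0" k]
  unfolding geom_def by simp

section \<open>Weighted norms on the half-line\<close>

abbreviation HL :: "real measure" where
  "HL \<equiv> lebesgue_on {0..}"

lemma space_HL [simp]: "space HL = {0..}"
  by simp

lemma measurable_ident_HL [measurable]: "(\<lambda>x. x) \<in> borel_measurable HL"
  by (metis measurable_ident_sets measurable_restrict_space1 sets_lborel measurable_completion)

lemma MplusD [measurable_dest]: "f \<in> Mplus \<Longrightarrow> f \<in> borel_measurable HL"
  by (simp add: Mplus_def)

lemma MplusI: "f \<in> borel_measurable HL \<Longrightarrow> f \<in> Mplus"
  by (simp add: Mplus_def)

lemma set_nn_integral_HL: "(\<integral>\<^sup>+x\<in>{0..}. f x \<partial>lebesgue) = (\<integral>\<^sup>+x. f x \<partial>HL)"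
  by (subst nn_integral_restrict_space) auto

lemma set_nn_integral_subset_HL:
  "S \<subseteq> {0..} \<Longrightarrow> (\<integral>\<^sup>+x\<in>S. f x \<partial>lebesgue) = (\<integral>\<^sup>+x. f x * indicator S x \<partial>HL)"
  by (subst nn_integral_restrict_space) (auto intro!: nn_integral_cong split: split_indicator)

lemma AE_HL_neq: "AE x in HL. x \<noteq> a"
proof -
  have "AE x in lebesgue. x \<noteq> a"
    by (intro AE_completion AE_lborel_singleton)
  then have "AE x in lebesgue. x \<in> {0..} \<longrightarrow> x \<noteq> a"
    by eventually_elim simp
  then show ?thesis by (subst AE_restrict_space_iff) auto
qed

lemma AE_HL_pos: "AE x in HL. 0 < x"
  using AE_HL_neq[of 0] AE_space[of HL] by eventually_elim auto

lemma AE_HL_iff: "(AE x in HL. P x) \<longleftrightarrow> (AE x in lebesgue. 0 \<le> x \<longrightarrow> P x)"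
  by (subst AE_restrict_space_iff) auto

lemma wnorm_finite_eq:
  "0 < p \<Longrightarrow> wnorm (ennreal p) v f = (\<integral>\<^sup>+x. f x epowr p * v x \<partial>HL) epowr (1 / p)"
  by (simp add: wnorm_def set_nn_integral_HL)

lemma wnorm_epowr:
  "0 < p \<Longrightarrow> wnorm (ennreal p) v f epowr p = (\<integral>\<^sup>+x. f x epowr p * v x \<partial>HL)"
  by (simp add: wnorm_finite_eq epowr_inverse)

lemma wnorm_top_eq: "wnorm top v f = esssup HL (\<lambda>x. v x * f x)"
  by (simp add: wnorm_def)

lemma exponent_cases:
  assumes "0 < (q::ennreal)"
  obtains "q = top" | q' where "0 < q'" "q = ennreal q'"
  using assms by (cases q) auto

lemma wnorm_mono_AE:
  assumes "0 < q" "v \<in> Mplus" "f \<in> Mplus" "AE x in HL. f x \<le> g x"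
  shows "wnorm q v f \<le> wnorm q v g"
  using assms(1)
proof (cases q rule: exponent_cases)
  case 1
  note [measurable] = assms(2,3)
  have "AE x in HL. v x * f x \<le> v x * g x"
    using assms(4) by eventually_elim (auto intro: mult_left_mono)
  then show ?thesis unfolding 1 wnorm_top_eq
    by (intro esssup_AE_mono) auto
next
  case (2 q')
  have "AE x in HL. f x epowr q' * v x \<le> g x epowr q' * v x"
    using assms(4) by eventually_elim (use 2 in \<open>auto intro!: mult_right_mono epowr_mono\<close>)
  then show ?thesis
    using 2 by (auto simp: wnorm_finite_eq intro!: epowr_mono nn_integral_mono_AE)
qed

lemma wnorm_mono:
  assumes "0 < q" "v \<in> Mplus" "f \<in> Mplus" "\<And>x. 0 < x \<Longrightarrow> f x \<le> g x"
  shows "wnorm q v f \<le> wnorm q v g"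
  by (rule wnorm_mono_AE[OF assms(1-3)]) (use AE_HL_pos in \<open>eventually_elim, auto intro: assms(4)\<close>)

lemma wnorm_cong:
  assumes "0 < q" "v \<in> Mplus" "f \<in> Mplus" "g \<in> Mplus" "\<And>x. 0 < x \<Longrightarrow> f x = g x"
  shows "wnorm q v f = wnorm q v g"
  by (rule antisym; rule wnorm_mono) (use assms in auto)

lemma esssup_cmult_le:
  fixes g :: "real \<Rightarrow> ennreal"
  assumes [measurable]: "g \<in> borel_measurable M"
  shows "esssup M (\<lambda>x. c * g x) \<le> c * esssup M g"
  by (rule esssup_I) (use esssup_AE[of g M] in \<open>auto elim!: eventually_mono intro: mult_left_mono\<close>)

text \<open>For finite c > 0 the reverse inequality is the previous lemma applied with 1/c. For c =
  \<infinity>, a finite essential supremum of c g forces g = 0 almost everywhere.\<close>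

lemma esssup_cmult_ennreal:
  fixes g :: "real \<Rightarrow> ennreal"
  assumes [measurable]: "g \<in> borel_measurable M"
  shows "esssup M (\<lambda>x. c * g x) = c * esssup M g"
proof (rule antisym[OF esssup_cmult_le[OF assms]])
  show "c * esssup M g \<le> esssup M (\<lambda>x. c * g x)"
  proof (cases c)
    case (real c')
    show ?thesis
    proof (cases "c' = 0")
      case False
      with real have c: "ennreal (1 / c') * c = 1" "c * ennreal (1 / c') = 1" by (auto simp flip: ennreal_mult)
      have "esssup M g = esssup M (\<lambda>x. ennreal (1 / c') * (c * g x))"
        by (simp add: mult.assoc[symmetric] c)
      also have "\<dots> \<le> ennreal (1 / c') * esssup M (\<lambda>x. c * g x)"
        by (rule esssup_cmult_le) simp
      finally have "c * esssup M g \<le> c * (ennreal (1 / c') * esssup M (\<lambda>x. c * g x))"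
        by (rule mult_left_mono) simp
      then show ?thesis by (simp add: mult.assoc[symmetric] c)
    qed (use real in simp)
  next
    case top
    show ?thesis
    proof (cases "esssup M g = 0 \<or> esssup M (\<lambda>x. c * g x) = top")
      case False
      have "AE x in M. c * g x \<le> esssup M (\<lambda>x. c * g x)" by (rule esssup_AE)
      then have "AE x in M. g x \<le> 0"
        by eventually_elim (use False top in \<open>auto simp: ennreal_top_mult top_unique split: if_splits\<close>)
      then have "esssup M g \<le> 0" by (intro esssup_I) auto
      with False show ?thesis by simp
    qed auto
  qed
qed

lemma wnorm_cmult:
  assumes "0 < q" "v \<in> Mplus" "f \<in> Mplus"
  shows "wnorm q v (\<lambda>x. c * f x) = c * wnorm q v f"
  using assms(1)
proof (cases q rule: exponent_cases)
  case 1
  note [measurable] = assms(2,3)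
  have "esssup HL (\<lambda>x. v x * (c * f x)) = esssup HL (\<lambda>x. c * (v x * f x))"
    by (simp add: mult_ac)
  then show ?thesis unfolding 1 wnorm_top_eq by (simp add: esssup_cmult_ennreal)
next
  case (2 q')
  note [measurable] = assms(2,3)
  show ?thesis
    using 2 by (simp add: wnorm_finite_eq epowr_mult mult.assoc nn_integral_cmult epowr_inverse)
qed

text \<open>The constant in the quasi-triangle inequality; \<^term>\<open>enn2real top = 0\<close> gives the value 2 for \<open>q = \<infinity>\<close>.\<close>

definition quasi :: "ennreal \<Rightarrow> ennreal" where
  "quasi q = ennreal (2 * 2 powr (1 / enn2real q))"

lemma quasi_less_top [simp]: "quasi q < top"
  by (simp add: quasi_def)

text \<open>For finite q the power inequality \<open>epowr_add_le\<close> is used twice: inside the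
  integral it gives the factor 2 after taking roots, and for the outer root 1/q it gives 2^(1/q).
  This covers exponents below 1.\<close>

lemma wnorm_add_le:
  assumes "0 < q" "v \<in> Mplus" "f \<in> Mplus" "g \<in> Mplus"
  shows "wnorm q v (\<lambda>x. f x + g x) \<le> quasi q * (wnorm q v f + wnorm q v g)"
  using assms(1)
proof (cases q rule: exponent_cases)
  case 1
  note [measurable] = assms(2-4)
  have "esssup HL (\<lambda>x. v x * (f x + g x)) \<le> esssup HL (\<lambda>x. v x * f x) + esssup HL (\<lambda>x. v x * g x)"
  proof (rule esssup_I)
    show "AE x in HL. v x * (f x + g x) \<le> esssup HL (\<lambda>x. v x * f x) + esssup HL (\<lambda>x. v x * g x)"
      using esssup_AE[of "\<lambda>x. v x * f x" HL] esssup_AE[of "\<lambda>x. v x * g x" HL]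
      by eventually_elim (auto simp: distrib_left intro: add_mono)
  qed simp
  also have "\<dots> \<le> quasi q * (esssup HL (\<lambda>x. v x * f x) + esssup HL (\<lambda>x. v x * g x))"
    by (simp add: quasi_def 1 mult_2 add_increasing)
  finally show ?thesis unfolding 1 wnorm_top_eq .
next
  case (2 q')
  note [measurable] = assms(2-4)
  let ?F = "\<integral>\<^sup>+x. f x epowr q' * v x \<partial>HL" and ?G = "\<integral>\<^sup>+x. g x epowr q' * v x \<partial>HL"
  have "(\<integral>\<^sup>+x. (f x + g x) epowr q' * v x \<partial>HL)
      \<le> (\<integral>\<^sup>+x. ennreal (2 powr q') * (f x epowr q' + g x epowr q') * v x \<partial>HL)"
    using 2 by (intro nn_integral_mono mult_right_mono epowr_add_le) auto
  also have "\<dots> = ennreal (2 powr q') * (?F + ?G)"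
    by (simp add: distrib_right mult.assoc nn_integral_cmult nn_integral_add)
  finally have "(\<integral>\<^sup>+x. (f x + g x) epowr q' * v x \<partial>HL) epowr (1 / q') \<le> (ennreal (2 powr q') * (?F + ?G)) epowr (1 / q')"
    using 2 by (intro epowr_mono) auto
  also have "\<dots> = 2 * (?F + ?G) epowr (1 / q')"
    using 2 by (simp add: epowr_mult powr_powr)
  also have "\<dots> \<le> 2 * (ennreal (2 powr (1 / q')) * (?F epowr (1 / q') + ?G epowr (1 / q')))"
    using 2 by (intro mult_left_mono epowr_add_le) auto
  also have "\<dots> = quasi q * (?F epowr (1 / q') + ?G epowr (1 / q'))"
    using 2 by (simp add: quasi_def ennreal_mult mult.assoc)
  finally show ?thesis using 2 by (simp add: wnorm_finite_eq)
qed

text \<open>The sequence norm in l^q of 2^(-a n), n \<ge> 0; for q = \<infinity> it is the supremum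
  1, attained at n = 0.\<close>

definition block_const :: "ennreal \<Rightarrow> real \<Rightarrow> ennreal" where
  "block_const q a = (if q = top then 1 else geom (a * enn2real q) epowr (1 / enn2real q))"

lemma block_const_less_top: "0 < q \<Longrightarrow> 0 < a \<Longrightarrow> block_const q a < top"
  by (erule exponent_cases) (auto simp: block_const_def geom_less_top)

text \<open>Geometric decay of the blocks replaces the discrete Hardy inequality, for every \<open>q\<close> at once.\<close>

lemma wnorm_cut_le_blocks:
  fixes x :: "int \<Rightarrow> real"
  assumes q: "0 < q" and v: "v \<in> Mplus" and g: "g \<in> Mplus"
    and cover: "\<And>y. 0 < y \<Longrightarrow> y \<le> x (k + 1) \<Longrightarrow> \<exists>j\<le>k. x j < y \<and> y \<le> x (j + 1)"
    and le: "\<And>j. j \<le> k \<Longrightarrow> wnorm q v (\<lambda>y. indicator {x j<..x (j + 1)} y * g y)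
      \<le> ennreal (2 powr (- a * real_of_int (k - j))) * \<rho>"
    and a: "0 \<le> a"
  shows "wnorm q v (\<lambda>y. indicator {0<..x (k + 1)} y * g y) \<le> block_const q a * \<rho>"
  using q
proof (cases q rule: exponent_cases)
  case 1
  note [measurable] = v g
  have "AE y in HL. j \<le> k \<longrightarrow> v y * (indicator {x j<..x (j + 1)} y * g y) \<le> \<rho>" for j
  proof (cases "j \<le> k")
    case True
    have "esssup HL (\<lambda>y. v y * (indicator {x j<..x (j + 1)} y * g y)) \<le> ennreal (2 powr (- a * real_of_int (k - j))) * \<rho>"
      using le[OF True] unfolding 1 wnorm_top_eq .
    also have "\<dots> \<le> 1 * \<rho>"
      using a True by (intro mult_right_mono) (auto intro!: powr_le_one_le[THEN order_trans] simp: powr_le_cancel_iff[of 2 _ 0, simplified] mult_le_0_iff)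
    finally show ?thesis
      using esssup_AE[of "\<lambda>y. v y * (indicator {x j<..x (j + 1)} y * g y)" HL]
      by (auto elim!: eventually_mono)
  qed simp
  then have "AE y in HL. \<forall>j. j \<le> k \<longrightarrow> v y * (indicator {x j<..x (j + 1)} y * g y) \<le> \<rho>"
    by (simp add: AE_all_countable)
  then have "AE y in HL. v y * (indicator {0<..x (k + 1)} y * g y) \<le> \<rho>"
  proof eventually_elim
    case (elim y)
    show ?case
    proof (cases "y \<in> {0<..x (k + 1)}")
      case True
      then obtain j where "j \<le> k" "x j < y" "y \<le> x (j + 1)" using cover[of y] by auto
      then show ?thesis using elim[rule_format, of j] True by simp
    qed auto
  qed
  then have "esssup HL (\<lambda>y. v y * (indicator {0<..x (k + 1)} y * g y)) \<le> \<rho>"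
    by (intro esssup_I) auto
  then show ?thesis unfolding 1 wnorm_top_eq block_const_def by simp
next
  case (2 q')
  note [measurable] = v g
  let ?h = "\<lambda>j y. (indicator {x j<..x (j + 1)} y * g y) epowr q' * v y"
  have "(\<integral>\<^sup>+y. (indicator {0<..x (k + 1)} y * g y) epowr q' * v y \<partial>HL)
      \<le> (\<integral>\<^sup>+y. int_sum (\<lambda>j. if j \<le> k then ?h j y else 0) \<partial>HL)"
  proof (intro nn_integral_mono)
    fix y
    show "(indicator {0<..x (k + 1)} y * g y) epowr q' * v y \<le> int_sum (\<lambda>j. if j \<le> k then ?h j y else 0)"
    proof (cases "y \<in> {0<..x (k + 1)}")
      case True
      then obtain j where "j \<le> k" "x j < y" "y \<le> x (j + 1)" using cover[of y] by auto
      then have "(indicator {0<..x (k + 1)} y * g y) epowr q' * v y = (if j \<le> k then ?h j y else 0)"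
        using True by simp
      also have "\<dots> \<le> int_sum (\<lambda>j. if j \<le> k then ?h j y else 0)"
        by (rule int_sum_upper)
      finally show ?thesis .
    qed auto
  qed
  also have "\<dots> = int_sum (\<lambda>j. \<integral>\<^sup>+y. (if j \<le> k then ?h j y else 0) \<partial>HL)"
    by (rule nn_integral_count_space_nn_integral) auto
  also have "\<dots> \<le> int_sum (\<lambda>j. (if j \<le> k then ennreal (2 powr (- (a * q') * real_of_int (k - j))) else 0) * \<rho> epowr q')"
  proof (rule nn_integral_mono)
    fix j
    have "(\<integral>\<^sup>+y. ?h j y \<partial>HL) \<le> ennreal (2 powr (- (a * q') * real_of_int (k - j))) * \<rho> epowr q'" if "j \<le> k"
    proof -
      have "(\<integral>\<^sup>+y. ?h j y \<partial>HL) = wnorm q v (\<lambda>y. indicator {x j<..x (j + 1)} y * g y) epowr q'"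
        using 2 by (simp add: wnorm_epowr)
      also have "\<dots> \<le> (ennreal (2 powr (- a * real_of_int (k - j))) * \<rho>) epowr q'"
        using le[OF that] 2 by (intro epowr_mono) auto
      also have "\<dots> = ennreal (2 powr (- (a * q') * real_of_int (k - j))) * \<rho> epowr q'"
        by (simp add: epowr_mult powr_powr mult_ac)
      finally show ?thesis .
    qed
    then show "(\<integral>\<^sup>+y. (if j \<le> k then ?h j y else 0) \<partial>HL)
      \<le> (if j \<le> k then ennreal (2 powr (- (a * q') * real_of_int (k - j))) else 0) * \<rho> epowr q'"
      by auto
  qed
  also have "\<dots> = geom (a * q') * \<rho> epowr q'"
    by (simp only: nn_integral_multc borel_measurable_count_space int_sum_geom_le)
  finally have "(\<integral>\<^sup>+y. (indicator {0<..x (k + 1)} y * g y) epowr q' * v y \<partial>HL) epowr (1 / q') \<le> (geom (a * q') * \<rho> epowr q') epowr (1 / q')"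
    using 2 by (intro epowr_mono) auto
  then show ?thesis
    using 2 by (simp add: wnorm_finite_eq block_const_def epowr_mult epowr_inverse)
qed

text \<open>End points are null sets. With the next lemma, the inner expression of
  \<open>T_op\<close> becomes, for finite and infinite q alike, the norm of a function cut to
  {0<..x}, as in \<open>H_cut\<close>.\<close>

lemma cut_integral_eq:
  assumes "0 < q"
  shows "(\<integral>\<^sup>+y\<in>{0..x}. (w y * g y epowr q) \<partial>lebesgue) epowr (1 / q)
    = wnorm (ennreal q) w (\<lambda>y. indicator {0<..x} y * g y)"
proof -
  have "(\<integral>\<^sup>+y\<in>{0..x}. (w y * g y epowr q) \<partial>lebesgue) = (\<integral>\<^sup>+y. w y * g y epowr q * indicator {0..x} y \<partial>HL)"
    by (rule set_nn_integral_subset_HL) auto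
  also have "\<dots> = (\<integral>\<^sup>+y. (indicator {0<..x} y * g y) epowr q * w y \<partial>HL)"
    by (rule nn_integral_cong_AE) (use AE_HL_pos in \<open>eventually_elim, auto simp: mult_ac split: split_indicator\<close>)
  finally show ?thesis using assms by (simp add: wnorm_finite_eq)
qed

lemma cut_esssup_eq:
  assumes w: "w \<in> Mplus" and g: "g \<in> Mplus"
  shows "esssup (lebesgue_on {0<..<x}) (\<lambda>y. w y * g y) = wnorm top w (\<lambda>y. indicator {0<..x} y * g y)"
proof (rule antisym)
  note [measurable] = w g
  have meas: "(\<lambda>y. w y * g y) \<in> borel_measurable (lebesgue_on {0<..<x})"
    by (rule measurable_restrict_mono[of _ _ "{0..}"]) auto
  have AE_iff: "(AE y in lebesgue_on {0<..<x}. P y) \<longleftrightarrow> (AE y in HL. y \<in> {0<..<x} \<longrightarrow> P y)" for P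
    unfolding AE_HL_iff by (subst AE_restrict_space_iff) (auto intro!: AE_cong)
  show "esssup (lebesgue_on {0<..<x}) (\<lambda>y. w y * g y) \<le> wnorm top w (\<lambda>y. indicator {0<..x} y * g y)"
    unfolding wnorm_top_eq
  proof (rule esssup_I[OF meas])
    show "AE y in lebesgue_on {0<..<x}. w y * g y \<le> esssup HL (\<lambda>x'. w x' * (indicator {0<..x} x' * g x'))"
      unfolding AE_iff
      using esssup_AE[of "\<lambda>y. w y * (indicator {0<..x} y * g y)" HL]
      by eventually_elim auto
  qed
  show "wnorm top w (\<lambda>y. indicator {0<..x} y * g y) \<le> esssup (lebesgue_on {0<..<x}) (\<lambda>y. w y * g y)"
    unfolding wnorm_top_eq
  proof (rule esssup_I)
    have "AE y in lebesgue_on {0<..<x}. w y * g y \<le> esssup (lebesgue_on {0<..<x}) (\<lambda>y. w y * g y)"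
      by (rule esssup_AE)
    then show "AE y in HL. w y * (indicator {0<..x} y * g y) \<le> esssup (lebesgue_on {0<..<x}) (\<lambda>y. w y * g y)"
      unfolding AE_iff using AE_HL_neq[of x]
      by eventually_elim (auto split: split_indicator)
  qed simp
qed

section \<open>Level points of the tail\<close>

lemma kernel_measurable:
  assumes "oinarov_kernel D k"
  shows "(\<lambda>(z, y). if 0 \<le> z \<and> 0 \<le> y then k z y else 0) \<in> borel_measurable (borel \<Otimes>\<^sub>M borel)"
proof -
  have "(\<lambda>(x, y). k x y) \<in> borel_measurable (restrict_space borel ({0..} \<times> {0..}))"
    using assms by (simp add: oinarov_kernel_def)
  then have "(\<lambda>p. indicator ({0..} \<times> {0..}) p *\<^sub>R (case p of (x, y) \<Rightarrow> k x y)) \<in> borel_measurable borel"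
    by (subst (asm) borel_measurable_restrict_space_iff) (auto intro!: borel_closed closed_Times)
  also have "(\<lambda>p. indicator ({0..} \<times> {0..}) p *\<^sub>R (case p of (x, y) \<Rightarrow> k x y))
    = (\<lambda>(z, y). if 0 \<le> z \<and> 0 \<le> y then k z y else 0)"
    by (auto simp: fun_eq_iff)
  finally show ?thesis by (simp add: borel_prod)
qed

lemma kernel_slice_Mplus:
  assumes "oinarov_kernel D k" "0 \<le> x"
  shows "(\<lambda>y. ennreal (k x y)) \<in> Mplus" "(\<lambda>z. ennreal (k z x)) \<in> Mplus"
proof -
  note [measurable] = kernel_measurable[OF assms(1)]
  have "(\<lambda>y. ennreal (case (x, y) of (z, y) \<Rightarrow> if 0 \<le> z \<and> 0 \<le> y then k z y else 0)) \<in> borel_measurable HL"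
    by measurable
  then show "(\<lambda>y. ennreal (k x y)) \<in> Mplus"
    unfolding Mplus_def by (rule measurable_cong[THEN iffD1, rotated]) (use assms(2) in auto)
  have "(\<lambda>y. ennreal (case (y, x) of (z, y) \<Rightarrow> if 0 \<le> z \<and> 0 \<le> y then k z y else 0)) \<in> borel_measurable HL"
    by measurable
  then show "(\<lambda>z. ennreal (k z x)) \<in> Mplus"
    unfolding Mplus_def by (rule measurable_cong[THEN iffD1, rotated]) (use assms(2) in auto)
qed

lemma H_op_eq:
  "0 \<le> x \<Longrightarrow> H_op k f x = (\<integral>\<^sup>+z. ennreal (k z x) * f z * indicator {x..} z \<partial>HL)"
  unfolding H_op_def by (rule set_nn_integral_subset_HL) auto

text \<open>Joint measurability is available for the Borel kernel, but f is only Lebesgue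
  measurable. Changing f on a null set into a Borel function g alters \<open>H_op k f y\<close> at
  no y, and for g the integral is Borel in the parameter y.\<close>

lemma H_op_Mplus:
  assumes k: "oinarov_kernel D k" and f: "f \<in> Mplus"
  shows "H_op k f \<in> Mplus"
proof -
  note [measurable] = kernel_measurable[OF k]
  have "(\<lambda>z. f z * indicator {0..} z) \<in> borel_measurable lebesgue"
    using f unfolding Mplus_def by (subst (asm) borel_measurable_restrict_space_iff_ennreal) auto
  then obtain g where g [measurable]: "g \<in> borel_measurable lborel"
    and eq: "AE z in lborel. f z * indicator {0..} z = g z"
    using completion_ex_borel_measurable by blast
  define G where "G y = (\<integral>\<^sup>+z. ennreal (case (z, y) of (z, y) \<Rightarrow> if 0 \<le> z \<and> 0 \<le> y then k z y else 0)
      * g z * (if y \<le> z then 1 else 0) \<partial>lborel)" for y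
  have [measurable]: "G \<in> borel_measurable borel"
    unfolding G_def by measurable
  have "H_op k f y = G y" if "0 \<le> y" for y
  proof -
    have "H_op k f y = (\<integral>\<^sup>+z. ennreal (k z y) * f z * indicator {y..} z \<partial>lborel)"
      unfolding H_op_def by (simp add: nn_integral_completion)
    also have "\<dots> = G y"
      unfolding G_def
    proof (rule nn_integral_cong_AE, use eq in eventually_elim)
      case (elim z)
      then show ?case using that by (auto simp: indicator_def split: if_splits)
    qed
    finally show ?thesis .
  qed
  moreover have "G \<in> borel_measurable HL"
    by (rule measurable_compose[OF measurable_ident_HL]) simp
  ultimately show ?thesis
    unfolding Mplus_def by (subst measurable_cong[of HL _ G]) auto
qed

lemma H_op_mono:
  assumes "0 \<le> x" "\<And>z. x \<le> z \<Longrightarrow> f z \<le> g z"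
  shows "H_op k f x \<le> H_op k g x"
  unfolding H_op_eq[OF assms(1)]
  by (intro nn_integral_mono) (auto intro!: mult_left_mono assms(2) split: split_indicator)

lemma H_op_cmult:
  assumes "oinarov_kernel D k" "f \<in> Mplus" "0 \<le> x"
  shows "H_op k (\<lambda>z. c * f z) x = c * H_op k f x"
proof -
  note [measurable] = kernel_slice_Mplus(2)[OF assms(1,3)] assms(2)
  show ?thesis
    unfolding H_op_eq[OF assms(3)] by (subst nn_integral_cmult[symmetric]) (auto simp: mult_ac)
qed

lemma H_op_add:
  assumes "oinarov_kernel D k" "f \<in> Mplus" "g \<in> Mplus" "0 \<le> x"
  shows "H_op k (\<lambda>z. f z + g z) x = H_op k f x + H_op k g x"
proof -
  note [measurable] = kernel_slice_Mplus(2)[OF assms(1,4)] assms(2,3)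
  show ?thesis
    unfolding H_op_eq[OF assms(4)] by (subst nn_integral_add[symmetric]) (auto simp: algebra_simps)
qed

section \<open>One-sided continuity and decay of the tail\<close>

lemma tail_eq_emeasure:
  assumes "u \<in> Mplus" "0 \<le> t"
  shows "tail u t = emeasure (density HL u) {t..}" "tail u t = emeasure (density HL u) {t<..}"
proof -
  note [measurable] = assms(1)
  have sets: "{t..} \<in> sets HL" "{t<..} \<in> sets HL"
    using assms(2) by (auto simp: sets_restrict_space_iff)
  have 1: "tail u t = (\<integral>\<^sup>+x. u x * indicator {t..} x \<partial>HL)"
    unfolding tail_def by (rule set_nn_integral_subset_HL) (use assms(2) in auto)
  also have 2: "\<dots> = (\<integral>\<^sup>+x. u x * indicator {t<..} x \<partial>HL)"
    by (rule nn_integral_cong_AE) (use AE_HL_neq[of t] in \<open>eventually_elim, auto split: split_indicator\<close>)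
  finally show "tail u t = emeasure (density HL u) {t<..}"
    using sets by (simp add: emeasure_density)
  show "tail u t = emeasure (density HL u) {t..}"
    using sets 1 by (simp add: emeasure_density)
qed

lemma tail_antimono:
  assumes "s \<le> t"
  shows "tail u t \<le> tail u s"
  unfolding tail_def using assms by (intro nn_integral_mono) (auto split: split_indicator)

lemma tail_split:
  assumes "u \<in> Mplus" "0 \<le> a" "a \<le> b"
  shows "tail u a = (\<integral>\<^sup>+x. u x * indicator {a<..b} x \<partial>HL) + tail u b"
proof -
  note [measurable] = assms(1)
  have sets: "{a<..} \<in> sets HL" "{b<..} \<in> sets HL"
    using assms by (auto simp: sets_restrict_space_iff)
  have "tail u a = (\<integral>\<^sup>+x. u x * indicator {a<..} x \<partial>HL)"
    using tail_eq_emeasure(2)[OF assms(1,2)] sets by (simp add: emeasure_density)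
  also have "\<dots> = (\<integral>\<^sup>+x. u x * indicator {a<..b} x + u x * indicator {b<..} x \<partial>HL)"
    using assms by (intro nn_integral_cong) (auto split: split_indicator)
  also have "\<dots> = (\<integral>\<^sup>+x. u x * indicator {a<..b} x \<partial>HL) + (\<integral>\<^sup>+x. u x * indicator {b<..} x \<partial>HL)"
    by (rule nn_integral_add) measurable
  also have "(\<integral>\<^sup>+x. u x * indicator {b<..} x \<partial>HL) = tail u b"
    using tail_eq_emeasure(2)[of u b] sets assms by (simp add: emeasure_density)
  finally show ?thesis .
qed

text \<open>Continuity from above of the measure with density u, along closed half-lines shrinking
  to {x..}; these must have finite measure.\<close>

lemma tail_left_continuous:
  assumes "u \<in> Mplus" and fin: "\<And>t. 0 < t \<Longrightarrow> tail u t < top" and "0 < x"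
    and le: "\<And>y. 0 < y \<Longrightarrow> y < x \<Longrightarrow> c \<le> tail u y"
  shows "c \<le> tail u x"
proof -
  \<comment> \<open>The offset 2 keeps every point strictly positive, where the tail is finite; with
    offset 1 the first point would be 0.\<close>
  let ?y = "\<lambda>n::nat. x - x / (2 + real n)"
  have y: "0 < ?y n" "?y n < x" for n using assms(3) by (auto simp: field_simps add_pos_nonneg)
  have sets: "{t..} \<in> sets (density HL u)" if "0 \<le> t" for t :: real
    using that by (auto simp: sets_restrict_space_iff)
  have "(\<Inter>n. {?y n..}) = {x..}"
  proof (intro equalityI subsetI)
    fix z assume "z \<in> (\<Inter>n. {?y n..})"
    then have "?y n \<le> z" for n by blast
    moreover have "?y \<longlonglongrightarrow> x - 0"
      by (intro tendsto_diff tendsto_const real_tendsto_divide_at_top[OF tendsto_const]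
          filterlim_tendsto_add_at_top[OF tendsto_const filterlim_real_sequentially])
    ultimately have "x - 0 \<le> z" by (intro LIMSEQ_le_const2) auto
    then show "z \<in> {x..}" by simp
  next
    fix z assume "z \<in> {x..}"
    then have "?y n \<le> z" for n using y(2)[of n] by (meson atLeast_iff less_imp_le order_trans)
    then show "z \<in> (\<Inter>n. {?y n..})" by blast
  qed
  moreover have "(INF n. emeasure (density HL u) {?y n..}) = emeasure (density HL u) (\<Inter>n. {?y n..})"
  proof (rule INF_emeasure_decseq)
    show "range (\<lambda>n. {?y n..}) \<subseteq> sets (density HL u)"
      using sets[OF less_imp_le[OF y(1)]] by blast
    show "decseq (\<lambda>n. {?y n..})"
    proof (rule decseq_SucI)
      fix n
      have "x / (2 + real (Suc n)) \<le> x / (2 + real n)"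
        using assms(3) by (intro divide_left_mono) auto
      then have "?y n \<le> ?y (Suc n)" by linarith
      then show "{?y (Suc n)..} \<subseteq> {?y n..}" by auto
    qed
    show "emeasure (density HL u) {?y n..} \<noteq> \<infinity>" for n
      using fin[OF y(1)[of n]] unfolding tail_eq_emeasure(1)[OF assms(1) less_imp_le[OF y(1)[of n]]] infinity_ennreal_def
      by (rule less_imp_neq)
  qed
  moreover have "tail u x = emeasure (density HL u) {x..}"
    by (rule tail_eq_emeasure) (use assms in auto)
  moreover have "tail u (?y n) = emeasure (density HL u) {?y n..}" for n
    by (rule tail_eq_emeasure[OF assms(1) less_imp_le[OF y(1)]])
  ultimately have "tail u x = (INF n. tail u (?y n))"
    by presburger
  also have "\<dots> \<ge> c" using y by (auto intro!: INF_greatest le)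
  finally show ?thesis .
qed

text \<open>Continuity from below: the half-lines {y..} with y > x fill {x<..}, which has the same
  measure as {x..} because points are null. The case x = 0 with infinite total mass is
  included.\<close>

lemma tail_right_continuous:
  assumes "u \<in> Mplus" "0 \<le> x" and le: "\<And>y. x < y \<Longrightarrow> tail u y \<le> c"
  shows "tail u x \<le> c"
proof -
  let ?y = "\<lambda>n::nat. x + 1 / (1 + real n)"
  have y: "x < ?y n" for n by (auto simp: field_simps)
  have y0: "0 \<le> ?y n" for n using y[of n] assms(2) by linarith
  have sets: "{t..} \<in> sets (density HL u)" if "0 \<le> t" for t :: real
    using that by (auto simp: sets_restrict_space_iff)
  have "(\<Union>n. {?y n..}) = {x<..}"
  proof (intro equalityI subsetI)
    fix z assume "z \<in> {x<..}"
    then obtain n where "inverse (real (Suc n)) < z - x"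
      using reals_Archimedean[of "z - x"] by auto
    then have "?y n \<le> z" by (simp add: inverse_eq_divide)
    then show "z \<in> (\<Union>n. {?y n..})" by blast
  next
    fix z assume "z \<in> (\<Union>n. {?y n..})"
    then obtain n where "?y n \<le> z" by blast
    with y[of n] have "x < z" by (rule less_le_trans)
    then show "z \<in> {x<..}" by simp
  qed
  moreover have "(SUP n. emeasure (density HL u) {?y n..}) = emeasure (density HL u) (\<Union>n. {?y n..})"
  proof (rule SUP_emeasure_incseq)
    show "range (\<lambda>n. {?y n..}) \<subseteq> sets (density HL u)"
      using sets[OF y0] by blast
    show "incseq (\<lambda>n. {?y n..})"
    proof (rule incseq_SucI)
      fix n
      have "1 / (1 + real (Suc n)) \<le> 1 / (1 + real n)"
        by (intro divide_left_mono) auto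
      then have "?y (Suc n) \<le> ?y n" by linarith
      then show "{?y n..} \<subseteq> {?y (Suc n)..}" by auto
    qed
  qed
  moreover have "tail u (?y n) = emeasure (density HL u) {?y n..}" for n
    by (rule tail_eq_emeasure[OF assms(1) y0])
  ultimately have "tail u x = (SUP n. tail u (?y n))"
    using tail_eq_emeasure(2)[OF assms(1,2)] by presburger
  also have "\<dots> \<le> c" using y by (auto intro!: SUP_least le)
  finally show ?thesis .
qed

text \<open>Otherwise the half-lines {1 + n..}, of finite measure and with empty intersection, would
  all have measure at least c. This makes the level sets bounded, so that their suprema are
  meaningful.\<close>

lemma tail_eventually_small:
  assumes "u \<in> Mplus" and fin: "\<And>t. 0 < t \<Longrightarrow> tail u t < top" and "0 < c"
  shows "\<exists>y>0. tail u y < c"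
proof (rule ccontr)
  assume "\<not> ?thesis"
  then have le: "c \<le> tail u (1 + real n)" for n by (metis add_pos_nonneg not_less of_nat_0_le_iff zero_less_one)
  have eq: "tail u (1 + real n) = emeasure (density HL u) {1 + real n..}" for n
    by (rule tail_eq_emeasure) (auto simp: assms)
  have "(INF n. emeasure (density HL u) {1 + real n..}) = emeasure (density HL u) (\<Inter>n. {1 + real n..})"
  proof (rule INF_emeasure_decseq)
    show "range (\<lambda>n. {1 + real n..}) \<subseteq> sets (density HL u)"
      by (auto simp: sets_restrict_space_iff)
    show "decseq (\<lambda>n. {1 + real n..})" by (auto simp: decseq_def)
    show "emeasure (density HL u) {1 + real n..} \<noteq> \<infinity>" for n
      using fin[of "1 + real n"] eq[of n] by (simp add: add_pos_nonneg)
  qed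
  moreover have "(\<Inter>n. {1 + real n..}) = {}"
  proof -
    have "\<exists>n. z < 1 + real n" for z :: real
      using reals_Archimedean2[of z] by (metis add.commute less_add_one order.strict_trans)
    then show ?thesis by (fastforce simp: not_le[symmetric])
  qed
  ultimately have "(INF n. tail u (1 + real n)) = 0" by (simp add: eq)
  moreover have "c \<le> (INF n. tail u (1 + real n))" by (intro INF_greatest le)
  ultimately show False using assms(3) by simp
qed

section \<open>The generalised inverse of the tail\<close>

definition level_point :: "(real \<Rightarrow> ennreal) \<Rightarrow> ennreal \<Rightarrow> real" where
  "level_point u c = sup0 {y. y > 0 \<and> tail u y \<ge> c}"

context
  fixes u :: "real \<Rightarrow> ennreal"
  assumes u: "u \<in> Mplus" and fin: "\<And>t. 0 < t \<Longrightarrow> tail u t < top"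
begin

lemma bdd_above_level_set:
  assumes "0 < c"
  shows "bdd_above {y. y > 0 \<and> tail u y \<ge> c}"
proof -
  obtain b where "0 < b" "tail u b < c"
    using tail_eventually_small[OF u fin assms] by auto
  then have "y \<le> b" if "c \<le> tail u y" for y
    using tail_antimono[of b y u] that by (meson leD le_less_trans linear)
  then show ?thesis by (auto simp: bdd_above_def)
qed

lemma level_point_nonneg: "0 < c \<Longrightarrow> 0 \<le> level_point u c"
  unfolding level_point_def sup0_def
  using bdd_above_level_set[of c] by (auto intro: cSup_upper2 less_imp_le)

text \<open>The supremum is attained because the tail is left continuous at positive points. The
  equivalence turns comparisons of points into comparisons of levels.\<close>

lemma le_level_point_iff:
  assumes "0 < c" "0 < y"
  shows "y \<le> level_point u c \<longleftrightarrow> c \<le> tail u y"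
proof
  assume "c \<le> tail u y"
  then show "y \<le> level_point u c"
    unfolding level_point_def sup0_def using assms bdd_above_level_set[of c] by (auto intro: cSup_upper)
next
  have less: "c \<le> tail u z" if "0 < z" "z < level_point u c" for z
  proof -
    have "{y. y > 0 \<and> tail u y \<ge> c} \<noteq> {}"
    proof
      assume "{y. y > 0 \<and> tail u y \<ge> c} = {}"
      then have "level_point u c = 0" unfolding level_point_def sup0_def by (rule if_P)
      with that show False by simp
    qed
    with that have "z < Sup {y. y > 0 \<and> tail u y \<ge> c}"
      unfolding level_point_def sup0_def by presburger
    then obtain z' where "z' \<in> {y. y > 0 \<and> tail u y \<ge> c}" "z < z'"
      using \<open>{y. y > 0 \<and> tail u y \<ge> c} \<noteq> {}\<close> by (meson less_cSupD)
    then show ?thesis using tail_antimono[of z z' u] by auto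
  qed
  assume y: "y \<le> level_point u c"
  then have pos: "0 < level_point u c" using assms by simp
  have "c \<le> tail u (level_point u c)"
    by (rule tail_left_continuous[OF u fin pos]) (auto intro: less)
  then show "c \<le> tail u y" using tail_antimono[OF y, of u] by simp
qed

text \<open>Points beyond the level point have tails below c, and right continuity passes to the
  limit. The inequality can be strict only if the level point is 0, when the total mass may lie
  below c.\<close>

lemma tail_level_point_le: "0 < c \<Longrightarrow> tail u (level_point u c) \<le> c"
proof (rule tail_right_continuous[OF u level_point_nonneg])
  fix y assume c: "0 < c" and y: "level_point u c < y"
  then have "0 < y" using level_point_nonneg[OF c] by simp
  then show "tail u y \<le> c" using le_level_point_iff[OF c] y by (meson linear not_le)
qed

lemma tail_level_point: "0 < c \<Longrightarrow> 0 < level_point u c \<Longrightarrow> tail u (level_point u c) = c"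
  using le_level_point_iff[of c "level_point u c"] tail_level_point_le[of c] by auto

lemma level_point_antimono:
  assumes "0 < c" "c \<le> d"
  shows "level_point u d \<le> level_point u c"
proof (cases "level_point u d = 0")
  case True
  then show ?thesis using level_point_nonneg[OF assms(1)] by simp
next
  case False
  have d: "0 < d" using assms by simp
  then have "0 < level_point u d" using level_point_nonneg[of d] False by simp
  then show ?thesis
    using tail_level_point[OF d] le_level_point_iff[OF assms(1)] assms(2) by simp
qed

end

text \<open>Since \<open>zeta\<close>, \<open>zeta_inv\<close> and the points \<open>x j\<close> are
  all level points, antimonotonicity in the level compares them.\<close>

lemma zeta_eq_level_point: "zeta u t = level_point u (tail u t / 2)"
  by (simp add: zeta_def level_point_def)

lemma zeta_inv_eq_level_point: "zeta_inv u t = level_point u (2 * tail u t)"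
  by (simp add: zeta_inv_def level_point_def)

text \<open>The last assumption concerns the block with left end 0, which occurs when u is
  integrable. Its mass is the total mass minus the level at its right end, and this may be tiny for
  a badly placed L.\<close>

locale levels =
  fixes u :: "real \<Rightarrow> ennreal" and x :: "int \<Rightarrow> real" and L :: real
  assumes u: "u \<in> Mplus"
    and tail_finite: "\<And>t. 0 < t \<Longrightarrow> tail u t < top"
    and tail_pos: "\<And>t. 0 < t \<Longrightarrow> 0 < tail u t"
    and L_pos: "0 < L"
    and x_def: "\<And>k. x k = level_point u (ennreal (L * 2 powr (- real_of_int k)))"
    and first_block: "\<And>k. 0 < x (k + 1) \<Longrightarrow> x k = 0 \<Longrightarrow>
      ennreal (L * 2 powr (- real_of_int k) / 4) \<le> (\<integral>\<^sup>+t. u t * indicator {x k<..x (k + 1)} t \<partial>HL)"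
begin

definition l :: "int \<Rightarrow> real" where
  "l k = L * 2 powr (- real_of_int k)"

lemma l_pos [simp]: "0 < l k"
  using L_pos by (simp add: l_def)

lemma l_add: "l (k + j) = l k * 2 powr (- real_of_int j)"
  by (simp add: l_def powr_add[symmetric])

lemma l_Suc: "l (k + 1) = l k / 2"
  by (simp add: l_add powr_minus_divide)

lemma x_eq: "x k = level_point u (ennreal (l k))"
  by (simp add: x_def l_def)

lemma x_nonneg [simp]: "0 \<le> x k"
  unfolding x_eq by (rule level_point_nonneg[OF u tail_finite]) auto

lemma le_x_iff: "0 < t \<Longrightarrow> t \<le> x k \<longleftrightarrow> ennreal (l k) \<le> tail u t"
  unfolding x_eq by (rule le_level_point_iff[OF u tail_finite]) auto

lemma less_x_iff: "0 < t \<Longrightarrow> x k < t \<longleftrightarrow> tail u t < ennreal (l k)"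
  using le_x_iff[of t k] by (simp add: not_le[symmetric])

lemma x_mono: "x k \<le> x (k + 1)"
  unfolding x_eq
  by (rule level_point_antimono[OF u tail_finite]) (use l_pos[of k] in \<open>auto simp: l_Suc intro!: ennreal_leI\<close>)

lemma tail_x_le: "tail u (x k) \<le> ennreal (l k)"
  unfolding x_eq by (rule tail_level_point_le[OF u tail_finite]) auto

lemma tail_x: "0 < x k \<Longrightarrow> tail u (x k) = ennreal (l k)"
  unfolding x_eq by (rule tail_level_point[OF u tail_finite]) auto

lemma cover:
  assumes "0 < y"
  obtains k where "x k < y" "y \<le> x (k + 1)"
proof -
  define T where "T = enn2real (tail u y)"
  have T: "tail u y = ennreal T" "0 < T"
    using tail_finite[OF assms] tail_pos[OF assms] by (auto simp: T_def enn2real_positive_iff)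
  \<comment> \<open>Chosen so that \<open>l (k + 1)\<close> \<le> T < \<open>l k\<close>. The strict
    side has to be at k, because blocks are open on the left and closed on the right.\<close>
  define k where "k = \<lceil>- log 2 (T / L)\<rceil> - 1"
  have "real_of_int k < - log 2 (T / L)" "- log 2 (T / L) \<le> real_of_int (k + 1)"
    unfolding k_def by linarith+
  then have "log 2 (T / L) < - real_of_int k" "- real_of_int (k + 1) \<le> log 2 (T / L)" by linarith+
  then have "T / L < 2 powr (- real_of_int k)" "2 powr (- real_of_int (k + 1)) \<le> T / L"
    using T(2) L_pos by (auto simp: log_less_iff le_log_iff)
  then have "T < l k" "l (k + 1) \<le> T"
    using L_pos by (auto simp: l_def field_simps)
  then have "x k < y" "y \<le> x (k + 1)"
    using T by (auto simp: less_x_iff[OF assms] le_x_iff[OF assms] ennreal_less_iff)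
  then show ?thesis by (rule that)
qed

lemma cover_below:
  assumes "0 < y" "y \<le> x (k + 1)"
  shows "\<exists>j\<le>k. x j < y \<and> y \<le> x (j + 1)"
proof -
  obtain j where j: "x j < y" "y \<le> x (j + 1)" using cover[OF assms(1)] .
  have "j \<le> k"
  proof (rule ccontr)
    assume "\<not> j \<le> k"
    then have "k + 1 \<le> j" by simp
    then have "x (k + 1) \<le> x j"
      by (induction j rule: int_ge_induct) (use x_mono order_trans in auto)
    with j assms show False by simp
  qed
  with j show ?thesis by blast
qed

lemma block_unique:
  assumes "x j < y" "y \<le> x (j + 1)" "x k < y" "y \<le> x (k + 1)"
  shows "j = k"
proof -
  have 0: "0 < y" using assms(1) x_nonneg[of j] by linarith
  obtain i where "i \<le> k" "x i < y" "y \<le> x (i + 1)" using cover_below[OF 0 assms(4)] by blast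
  have *: "j \<le> k" if "x j < y" "y \<le> x (k + 1)" for j k
  proof (rule ccontr)
    assume "\<not> j \<le> k"
    then have "k + 1 \<le> j" by simp
    then have "x (k + 1) \<le> x j"
      by (induction j rule: int_ge_induct) (use x_mono order_trans in auto)
    with that show False by simp
  qed
  show ?thesis using *[of j k] *[of k j] assms by simp
qed

definition mass :: "int \<Rightarrow> ennreal" where
  "mass k = (\<integral>\<^sup>+t. u t * indicator {x k<..x (k + 1)} t \<partial>HL)"

lemma tail_x_eq_mass: "tail u (x k) = mass k + tail u (x (k + 1))"
  unfolding mass_def by (rule tail_split[OF u x_nonneg x_mono])

lemma mass_le: "mass k \<le> ennreal (l k)"
  using tail_x_eq_mass[of k] tail_x_le[of k] by (metis add_increasing2 dual_order.trans order_refl zero_le)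

text \<open>A block with positive left end has mass exactly \<open>l k / 2\<close>, the difference
  of consecutive levels; the quarter is what the block starting at 0 provides. Empty blocks at 0 are
  excluded by the hypothesis.\<close>

lemma mass_ge:
  assumes "0 < x (k + 1)"
  shows "ennreal (l k / 4) \<le> mass k"
proof (cases "x k = 0")
  case True
  then show ?thesis using first_block[OF assms] by (simp add: mass_def l_def)
next
  case False
  then have "0 < x k" using x_nonneg[of k] by linarith
  then have eq: "ennreal (l k) = mass k + ennreal (l (k + 1))"
    using tail_x_eq_mass[of k] tail_x[of k] tail_x[OF assms] by simp
  have "mass k < top" using mass_le[of k] by (simp add: le_less_trans)
  then obtain m where m: "mass k = ennreal m" "0 \<le> m" by (cases "mass k") auto
  with eq have "l k = m + l (k + 1)" by (simp flip: ennreal_plus add: less_imp_le)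
  then have "l k / 4 \<le> m" using l_pos[of k] l_Suc[of k] by linarith
  then show ?thesis using m by simp
qed

lemma tail_block:
  assumes "x k < t" "t \<le> x (k + 1)"
  shows "ennreal (l (k + 1)) \<le> tail u t" "tail u t \<le> ennreal (l k)"
proof -
  have "0 < t" using assms(1) x_nonneg[of k] by linarith
  then show "ennreal (l (k + 1)) \<le> tail u t" "tail u t \<le> ennreal (l k)"
    using assms le_x_iff[of t "k + 1"] less_x_iff[of t k] by auto
qed

text \<open>On block k the tail lies between \<open>l (k + 1)\<close> and \<open>l k\<close>, so
  half of it lies between \<open>l (k + 2)\<close> and \<open>l (k + 1)\<close>, and its double is
  at least \<open>l k\<close>. The last bound is needed because \<open>H_block\<close> integrates up
  to \<open>zeta u d\<close>, and d is itself \<open>zeta u t\<close>.\<close>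

lemma zeta_bounds:
  assumes "x k < t" "t \<le> x (k + 1)"
  shows "0 \<le> zeta_inv u t" "zeta_inv u t \<le> x k" "x (k + 1) \<le> zeta u t" "zeta u t \<le> x (k + 2)"
    "x (k + 2) \<le> zeta u (zeta u t)"
proof -
  note antimono = level_point_antimono[OF u tail_finite]
  have t: "0 < t" using assms(1) x_nonneg[of k] by linarith
  then obtain T where T: "tail u t = ennreal T" "0 < T"
    using tail_finite[OF t] tail_pos[OF t] by (cases "tail u t") auto
  have T2: "tail u t / 2 = ennreal (T / 2)" "2 * tail u t = ennreal (2 * T)"
    using T by (simp_all add: ennreal_mult divide_ennreal[symmetric])
  have lT: "l (k + 1) \<le> T" "T \<le> l k"
    using tail_block[OF assms] T l_pos[of k] by (simp_all add: ennreal_le_iff less_imp_le)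
  have l2: "l (k + 2) = l k / 4" using l_Suc[of "k + 1"] l_Suc[of k] by (simp add: add.assoc)
  show "0 \<le> zeta_inv u t"
    unfolding zeta_inv_eq_level_point T2
    by (rule level_point_nonneg[OF u tail_finite]) (use T in auto)
  show "zeta_inv u t \<le> x k"
    unfolding zeta_inv_eq_level_point x_eq T2
    by (rule antimono) (use lT l_Suc[of k] in \<open>auto intro!: ennreal_leI\<close>)
  show 1: "x (k + 1) \<le> zeta u t"
    unfolding zeta_eq_level_point x_eq T2
    by (rule antimono) (use lT T l_Suc[of k] in \<open>auto intro!: ennreal_leI\<close>)
  show "zeta u t \<le> x (k + 2)"
    unfolding zeta_eq_level_point x_eq T2
    by (rule antimono) (use lT T l_Suc[of k] l2 in \<open>auto intro!: ennreal_leI\<close>)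
  have z: "0 < zeta u t" using 1 t assms by linarith
  have "tail u (zeta u t) \<le> ennreal (T / 2)"
    using tail_level_point_le[OF u tail_finite, of "ennreal (T / 2)"] T
    unfolding zeta_eq_level_point T2 by simp
  then obtain S where S: "tail u (zeta u t) = ennreal S" "0 < S" "S \<le> T / 2"
    using tail_pos[OF z] T by (cases "tail u (zeta u t)") (auto simp: top_unique)
  have S2: "tail u (zeta u t) / 2 = ennreal (S / 2)"
    using S by (simp add: divide_ennreal[symmetric])
  show "x (k + 2) \<le> zeta u (zeta u t)"
    unfolding zeta_eq_level_point[of u "zeta u t"] x_eq S2
    by (rule antimono) (use lT S l_Suc[of k] l2 in \<open>auto intro!: ennreal_leI\<close>)
qed

end

text \<open>If \<open>\<integral>u\<close> is finite, the ratio \<open>4 / 3\<close> ensures that the first block has a mass comparable to its level.\<close>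

lemma levels_exist:
  assumes u: "u \<in> Mplus" and tail: "\<And>t. 0 < t \<Longrightarrow> 0 < tail u t \<and> tail u t < top"
  obtains x L where "levels u x L"
proof -
  have fin: "tail u t < top" if "0 < t" for t using tail[OF that] by simp
  have pos: "0 < tail u t" if "0 < t" for t using tail[OF that] by simp
  have U0: "0 < tail u 0" using pos[of 1] tail_antimono[of 0 1 u] by (simp add: less_le_trans)
  have pos_iff: "0 < level_point u c" if "0 < c" "c < tail u 0" for c
  proof (rule ccontr)
    assume "\<not> 0 < level_point u c"
    then have "tail u y \<le> c" if "0 < y" for y
      using le_level_point_iff[OF u fin \<open>0 < c\<close> that] that by (meson le_less_trans linear not_less)
    then have "tail u 0 \<le> c" by (rule tail_right_continuous[OF u order_refl])
    with that show False by simp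
  qed
  show ?thesis
  proof (cases "tail u 0 = top")
    case True
    \<comment> \<open>With infinite total mass every level is attained at a positive point, so the
      condition on the first block is vacuous and L = 1 will do.\<close>
    have "0 < level_point u (ennreal (1 * 2 powr (- real_of_int k)))" for k
      by (rule pos_iff) (auto simp: True)
    then have nz: "level_point u (ennreal (1 * 2 powr (- real_of_int k))) \<noteq> 0" for k
      by (metis less_irrefl)
    have "levels u (\<lambda>k. level_point u (ennreal (1 * 2 powr (- real_of_int k)))) 1"
      by (rule levels.intro[OF u fin pos zero_less_one refl]) (use nz in blast)+
    then show ?thesis by (rule that)
  next
    case False
    then obtain M where M: "tail u 0 = ennreal M" "0 < M"
      using U0 by (cases "tail u 0") auto
    \<comment> \<open>The total mass M is then 3 L / 4, strictly between the levels L / 2 and L.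
      Hence the block starting at 0 has index 0, and its mass is M - L / 2 = L / 4, exactly the
      required quarter.\<close>
    define L where "L = 4 / 3 * M"
    define x where "x k = level_point u (ennreal (L * 2 powr (- real_of_int k)))" for k
    have L: "0 < L" using M by (simp add: L_def)
    have "levels u x L"
    proof (rule levels.intro[OF u fin pos L x_def])
      fix k
      let ?l = "L * 2 powr (- real_of_int k)"
      assume k: "0 < x (k + 1)" "x k = 0"
      have l_Suc: "L * 2 powr (- real_of_int (k + 1)) = ?l / 2"
        by (simp add: powr_diff)
      have "ennreal M \<le> ennreal ?l"
        using pos_iff[of "ennreal ?l"] k(2) L by (auto simp: x_def M(1) not_less[symmetric])
      then have 1: "M \<le> ?l" using L by simp
      have tail1: "tail u (x (k + 1)) = ennreal (?l / 2)"
        using tail_level_point[OF u fin, of "ennreal (?l / 2)"] k(1) L unfolding x_def l_Suc by simp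
      have "tail u (x (k + 1)) \<le> tail u 0" using k by (intro tail_antimono) simp
      then have 2: "?l / 2 \<le> M" using M by (simp add: tail1)
      have "k = 0"
      proof -
        have "2 powr (- real_of_int k) \<ge> 3 / 4" "2 powr (- real_of_int k) \<le> 3 / 2"
          using 1 2 M(2) by (auto simp: L_def field_simps)
        then have "2 powr (- 1) < 2 powr (- real_of_int k)" "2 powr (- real_of_int k) < 2 powr 1"
          by (auto simp: powr_minus)
        then have "- 1 < - real_of_int k" "- real_of_int k < 1"
          by (simp_all only: powr_less_cancel_iff one_less_numeral_iff semiring_norm)
        then show ?thesis by linarith
      qed
      then have l: "?l = L" by simp
      have "ennreal M = (\<integral>\<^sup>+t. u t * indicator {x k<..x (k + 1)} t \<partial>HL) + ennreal (L / 2)"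
        using tail_split[OF u, of "x k" "x (k + 1)"] k tail1 M(1) unfolding l by simp
      moreover from this obtain m where m: "(\<integral>\<^sup>+t. u t * indicator {x k<..x (k + 1)} t \<partial>HL) = ennreal m" "0 \<le> m"
        by (cases "\<integral>\<^sup>+t. u t * indicator {x k<..x (k + 1)} t \<partial>HL") auto
      ultimately have "M = m + L / 2" using L M by (simp flip: ennreal_plus)
      then have "L / 4 \<le> m" by (simp add: L_def)
      then show "ennreal (?l / 4) \<le> (\<integral>\<^sup>+t. u t * indicator {x k<..x (k + 1)} t \<partial>HL)"
        unfolding l m by (rule ennreal_leI)
    qed
    then show ?thesis by (rule that)
  qed
qed

section \<open>Lower bounds\<close>

text \<open>Testing on functions of finite norm suffices. For infinite norm, C = 0 would give the
  right-hand side 0 * \<infinity> = 0, so C is enlarged by e > 0, which makes it infinite; the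
  infimum removes e again.\<close>

lemma least_const_le:
  assumes "\<And>f. f \<in> Mplus \<Longrightarrow> wnorm p v f < top \<Longrightarrow> L f \<le> C * wnorm p v f"
  shows "least_const p v L \<le> C"
proof (rule ennreal_le_epsilon)
  fix e :: real assume e: "0 < e"
  have "L f \<le> (C + ennreal e) * wnorm p v f" if f: "f \<in> Mplus" for f
  proof (cases "wnorm p v f < top")
    case True
    have "L f \<le> C * wnorm p v f" by (rule assms[OF f True])
    also have "\<dots> \<le> (C + ennreal e) * wnorm p v f" by (intro mult_right_mono) auto
    finally show ?thesis .
  next
    case False
    then show ?thesis using e by (simp add: less_top[symmetric] ennreal_mult_top)
  qed
  then show "least_const p v L \<le> C + ennreal e"
    unfolding least_const_def by (intro Inf_lower) auto
qed

text \<open>The infimum is attained on functions of finite norm. For norm 0 any admissible finite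
  constant already gives \<open>L f = 0\<close>; for norm n > 0 the excess e / n costs only
  e.\<close>

lemma least_const_bound:
  assumes "least_const p v L < top" "f \<in> Mplus" "wnorm p v f < top"
  shows "L f \<le> least_const p v L * wnorm p v f"
proof -
  have bound: "L f \<le> (least_const p v L + ennreal e) * wnorm p v f" if "0 < e" for e :: real
  proof -
    have "least_const p v L < least_const p v L + ennreal e"
      using assms(1) that by (cases "least_const p v L") (auto simp flip: ennreal_plus simp: ennreal_less_iff)
    then obtain C where "\<forall>f\<in>Mplus. L f \<le> C * wnorm p v f" and C: "C < least_const p v L + ennreal e"
      unfolding least_const_def Inf_less_iff by auto
    then have "L f \<le> C * wnorm p v f" using assms(2) by blast
    also have "\<dots> \<le> (least_const p v L + ennreal e) * wnorm p v f"
      using C by (intro mult_right_mono) auto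
    finally show ?thesis .
  qed
  show ?thesis
  proof (cases "wnorm p v f = 0")
    case True
    then show ?thesis using bound[of 1] by simp
  next
    case False
    then obtain n where n: "wnorm p v f = ennreal n" "0 < n"
      using assms(3) by (cases "wnorm p v f") auto
    show ?thesis
    proof (rule ennreal_le_epsilon)
      fix e :: real assume "0 < e"
      then have "L f \<le> (least_const p v L + ennreal (e / n)) * ennreal n"
        using bound[of "e / n"] n by simp
      also have "\<dots> = least_const p v L * wnorm p v f + ennreal e"
        using n \<open>0 < e\<close> by (simp add: distrib_right flip: ennreal_mult)
      finally show "L f \<le> least_const p v L * wnorm p v f + ennreal e" .
    qed
  qed
qed

lemma least_const_mono:
  assumes "\<And>f. f \<in> Mplus \<Longrightarrow> L f \<le> L' f"
  shows "least_const p v L \<le> least_const p v L'"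
  unfolding least_const_def by (intro Inf_superset_mono) (use assms order_trans in blast)

lemma least_const_cong:
  assumes "\<And>f. f \<in> Mplus \<Longrightarrow> L f = L' f"
  shows "least_const p v L = least_const p v L'"
  by (rule antisym; rule least_const_mono) (simp_all add: assms)

lemma zero_Mplus: "(\<lambda>z. 0) \<in> Mplus" and one_Mplus: "(\<lambda>z. 1) \<in> Mplus"
  by (auto intro: MplusI)

lemma cmult_Mplus: "f \<in> Mplus \<Longrightarrow> (\<lambda>z. c * f z) \<in> Mplus"
  by (auto simp: Mplus_def)

lemma cut_Mplus: "f \<in> Mplus \<Longrightarrow> A \<in> sets borel \<Longrightarrow> (\<lambda>z. indicator A z * f z) \<in> Mplus"
  by (rule MplusI) (measurable, auto)

text \<open>Half of a positive least constant is not admissible, so some f violates it. The strict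
  inequality makes the norm of f finite, \<open>least_const_bound\<close> makes it nonzero, and by
  homogeneity f can be normalised.\<close>

lemma near_extremal:
  assumes fin: "least_const p v L < top" and "0 < p" "v \<in> Mplus"
    and hom: "\<And>c f. f \<in> Mplus \<Longrightarrow> L (\<lambda>z. c * f z) = c * L f"
  shows "\<exists>g\<in>Mplus. wnorm p v g \<le> 1 \<and> least_const p v L / 2 \<le> L g"
proof (cases "least_const p v L = 0")
  case True
  have "wnorm p v (\<lambda>z. 0 * 0) = 0" using wnorm_cmult[OF assms(2,3) zero_Mplus, of 0] by simp
  then show ?thesis using True zero_Mplus by (intro bexI[of _ "\<lambda>z. 0"]) auto
next
  case False
  define N where "N = enn2real (least_const p v L)"
  have N: "least_const p v L = ennreal N" "0 < N"
    using False fin by (auto simp: N_def enn2real_positive_iff zero_less_iff_neq_zero)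
  have "ennreal (N / 2) < least_const p v L" using N by (simp add: ennreal_less_iff)
  then have "ennreal (N / 2) \<notin> {C. \<forall>f\<in>Mplus. L f \<le> C * wnorm p v f}"
    unfolding least_const_def by (meson Inf_lower not_less)
  then obtain f where f: "f \<in> Mplus" "ennreal (N / 2) * wnorm p v f < L f" by (auto simp: not_le)
  have "wnorm p v f \<noteq> top" using f(2) N by (auto simp: ennreal_mult_top)
  moreover have "wnorm p v f \<noteq> 0"
    using f(2) least_const_bound[OF fin f(1)] by auto
  ultimately obtain n where n: "wnorm p v f = ennreal n" "0 < n" by (cases "wnorm p v f") auto
  have "ennreal (1 / n) * ennreal n = 1" using n by (simp flip: ennreal_mult)
  then have "ennreal (N / 2) = ennreal (1 / n) * (ennreal (N / 2) * ennreal n)"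
    by (metis mult.left_commute mult.right_neutral)
  then have "least_const p v L / 2 = ennreal (1 / n) * (ennreal (N / 2) * ennreal n)"
    using N divide_ennreal[of N 2] by simp
  also have "\<dots> \<le> ennreal (1 / n) * L f" using f(2) n by (intro mult_left_mono) auto
  also have "\<dots> = L (\<lambda>z. ennreal (1 / n) * f z)" using hom[OF f(1)] by simp
  finally have "least_const p v L / 2 \<le> L (\<lambda>z. ennreal (1 / n) * f z)" .
  moreover have "wnorm p v (\<lambda>z. ennreal (1 / n) * f z) = 1"
    using wnorm_cmult[OF assms(2,3) f(1)] n by (simp flip: ennreal_mult)
  ultimately show ?thesis using cmult_Mplus[OF f(1)] by (metis order_refl)
qed

text \<open>Moving the upper limit of integration into the input reduces the block operator to a cut
  of \<open>H_op\<close>, for which measurability and monotonicity are known.\<close>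

lemma H_block_eq:
  "H_block k u c d f y = indicator {c<..d} y * H_op k (\<lambda>z. indicator {..zeta u d} z * f z) y"
proof -
  have "(\<integral>\<^sup>+z\<in>{y..zeta u d}. (ennreal (k z y) * f z) \<partial>lebesgue)
      = H_op k (\<lambda>z. indicator {..zeta u d} z * f z) y"
    unfolding H_op_def by (rule nn_integral_cong) (auto split: split_indicator)
  then show ?thesis by (simp add: H_block_def)
qed

section \<open>Reformulation by cut norms, and bounds for A0 and A1\<close>

locale iterated = levels u x L for u :: "real \<Rightarrow> ennreal" and x :: "int \<Rightarrow> real" and L :: real +
  fixes p r D :: real and q :: ennreal and v w :: "real \<Rightarrow> ennreal" and k :: "real \<Rightarrow> real \<Rightarrow> real"
  assumes p_pos: "0 < p" and r_pos: "0 < r" and q_pos: "0 < q" and D_ge: "1 \<le> D"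
    and v: "v \<in> Mplus" and w: "w \<in> Mplus" and k: "oinarov_kernel D k"
begin

abbreviation N :: "(real \<Rightarrow> ennreal) \<Rightarrow> ennreal" where
  "N f \<equiv> wnorm (ennreal p) v f"

abbreviation Phi :: "(real \<Rightarrow> ennreal) \<Rightarrow> ennreal" where
  "Phi g \<equiv> wnorm q w g"

abbreviation H :: "(real \<Rightarrow> ennreal) \<Rightarrow> real \<Rightarrow> ennreal" where
  "H \<equiv> H_op k"

abbreviation T :: "(real \<Rightarrow> ennreal) \<Rightarrow> real \<Rightarrow> ennreal" where
  "T f t \<equiv> Phi (\<lambda>y. indicator {0<..t} y * H f y)"

abbreviation LT :: "(real \<Rightarrow> ennreal) \<Rightarrow> ennreal" where
  "LT f \<equiv> (\<integral>\<^sup>+t. u t * T f t epowr r \<partial>HL) epowr (1 / r)"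

text \<open>\<open>W\<close> and \<open>K\<close> are the weight factors of \<open>A0\<close> and
  \<open>A1\<close>, written as norms over (0,t] of the constant 1 and of the kernel slice, so that
  finite and infinite q need no distinction.\<close>

abbreviation W :: "real \<Rightarrow> ennreal" where
  "W t \<equiv> Phi (\<lambda>y. indicator {0<..t} y)"

abbreviation K :: "real \<Rightarrow> ennreal" where
  "K t \<equiv> Phi (\<lambda>y. indicator {0<..t} y * ennreal (k t y))"

abbreviation I :: "(real \<Rightarrow> ennreal) \<Rightarrow> real \<Rightarrow> ennreal" where
  "I f t \<equiv> (\<integral>\<^sup>+z\<in>{t..}. f z \<partial>lebesgue)"

abbreviation CT :: ennreal where
  "CT \<equiv> C_T p q r u v w k"

lemma T_op_eq: "f \<in> Mplus \<Longrightarrow> T_op q w k f t = T f t"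
  using q_pos
  by (cases q rule: exponent_cases) (auto simp: T_op_def cut_esssup_eq w H_op_Mplus[OF k] cut_integral_eq)

lemma CT_eq: "CT = least_const (ennreal p) v LT"
  unfolding C_T_def op_norm_def
  by (rule least_const_cong) (simp add: wnorm_finite_eq r_pos T_op_eq mult.commute)

lemma A0_eq:
  "A0 p q r u v w k = least_const (ennreal p) v (\<lambda>f. (\<integral>\<^sup>+t. u t * W t epowr r * H f t epowr r \<partial>HL) epowr (1 / r))"
  using q_pos
proof (cases q rule: exponent_cases)
  case 1
  have "esssup (lebesgue_on {0<..<t}) w = W t" for t
    using cut_esssup_eq[OF w one_Mplus, of t] by (simp add: 1)
  then show ?thesis unfolding A0_def by (simp add: 1 set_nn_integral_HL)
next
  case (2 q')
  have "(\<integral>\<^sup>+y\<in>{0..t}. w y \<partial>lebesgue) epowr (r / q') = W t epowr r" for t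
  proof -
    have "W t = (\<integral>\<^sup>+y\<in>{0..t}. w y \<partial>lebesgue) epowr (1 / q')"
      using cut_integral_eq[where q=q' and x=t and w=w and g="\<lambda>_. 1"] 2 by simp
    then show ?thesis by (simp add: epowr_epowr)
  qed
  then show ?thesis unfolding A0_def using 2 by (simp add: set_nn_integral_HL)
qed

lemma A1_eq:
  "A1 p q r u v w k = least_const (ennreal p) v (\<lambda>f. (\<integral>\<^sup>+t. u t * K t epowr r * I f t epowr r \<partial>HL) epowr (1 / r))"
  using q_pos
proof (cases q rule: exponent_cases)
  case 1
  have "esssup (lebesgue_on {0<..<t}) (\<lambda>y. w y * ennreal (k t y)) = K t" if "0 \<le> t" for t
    using cut_esssup_eq[OF w kernel_slice_Mplus(1)[OF k that], of t] by (simp add: 1)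
  then have "(\<integral>\<^sup>+t. u t * esssup (lebesgue_on {0<..<t}) (\<lambda>y. w y * ennreal (k t y)) epowr r * I f t epowr r \<partial>HL)
    = (\<integral>\<^sup>+t. u t * K t epowr r * I f t epowr r \<partial>HL)" for f
    by (intro nn_integral_cong) auto
  then show ?thesis unfolding A1_def by (simp add: 1 set_nn_integral_HL)
next
  case (2 q')
  have "(\<integral>\<^sup>+y\<in>{0..t}. (ennreal (k t y) epowr q' * w y) \<partial>lebesgue) epowr (r / q') = K t epowr r" for t
  proof -
    have "K t = (\<integral>\<^sup>+y\<in>{0..t}. (ennreal (k t y) epowr q' * w y) \<partial>lebesgue) epowr (1 / q')"
      using cut_integral_eq[where q=q' and x=t and w=w and g="\<lambda>y. ennreal (k t y)"] 2
      by (simp only: mult.commute[of "w _"])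
    then show ?thesis by (simp add: epowr_epowr)
  qed
  then show ?thesis unfolding A1_def using 2 by (simp add: set_nn_integral_HL)
qed

text \<open>Dropping one nonnegative summand from the lower Oinarov bound shows that k is, up to the
  factor D, increasing in the first argument and decreasing in the second.\<close>

lemma kernel_ge:
  assumes "0 \<le> y" "y \<le> t" "t \<le> z"
  shows "ennreal (k z t) \<le> ennreal D * ennreal (k z y)" "ennreal (k t y) \<le> ennreal D * ennreal (k z y)"
    "ennreal (k z y) \<le> ennreal D * (ennreal (k z t) + ennreal (k t y))"
proof -
  have nonneg: "0 \<le> k z t" "0 \<le> k t y" "0 \<le> k z y"
    using k assms unfolding oinarov_kernel_def by auto
  have "1 / D * (k z t + k t y) \<le> k z y" "k z y \<le> D * (k z t + k t y)"
    using k assms unfolding oinarov_kernel_def by auto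
  then have "k z t \<le> D * k z y" "k t y \<le> D * k z y"
    using nonneg D_ge by (auto simp: field_simps)
  then show "ennreal (k z t) \<le> ennreal D * ennreal (k z y)" "ennreal (k t y) \<le> ennreal D * ennreal (k z y)"
    using nonneg D_ge by (auto simp flip: ennreal_mult intro!: ennreal_leI)
  show "ennreal (k z y) \<le> ennreal D * (ennreal (k z t) + ennreal (k t y))"
    using \<open>k z y \<le> D * (k z t + k t y)\<close> nonneg D_ge by (auto simp flip: ennreal_mult ennreal_plus intro!: ennreal_leI)
qed

lemma H_Mplus: "f \<in> Mplus \<Longrightarrow> H f \<in> Mplus"
  by (rule H_op_Mplus[OF k])

lemma cut_H_Mplus: "f \<in> Mplus \<Longrightarrow> (\<lambda>y. indicator {a<..b} y * H f y) \<in> Mplus"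
  by (rule cut_Mplus) (auto intro: H_Mplus)

lemma I_eq: "0 \<le> t \<Longrightarrow> I f t = (\<integral>\<^sup>+z. f z * indicator {t..} z \<partial>HL)"
  by (rule set_nn_integral_subset_HL) auto

text \<open>\<open>H f t\<close> is constant in y, so it moves into the norm and is compared there
  with \<open>H f y\<close> for y \<le> t, which integrates over more and has the larger kernel up
  to D. The factor D is carried by the input and released by homogeneity in
  \<open>LT_scaled_bound\<close>.\<close>

lemma W_H_le:
  assumes f: "f \<in> Mplus" and t: "0 \<le> t"
  shows "W t * H f t \<le> T (\<lambda>z. ennreal D * f z) t"
proof -
  have ind: "(\<lambda>y. indicator {0<..t} y) \<in> Mplus"
    using cut_Mplus[OF one_Mplus, of "{0<..t}"] by simp
  have "W t * H f t = Phi (\<lambda>y. H f t * indicator {0<..t} y)"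
    by (subst wnorm_cmult[OF q_pos w ind]) (rule mult.commute)
  also have "\<dots> \<le> T (\<lambda>z. ennreal D * f z) t"
  proof (rule wnorm_mono[OF q_pos w])
    show "(\<lambda>y. H f t * indicator {0<..t} y) \<in> Mplus" by (rule cmult_Mplus[OF ind])
    fix y :: real assume y: "0 < y"
    show "H f t * indicator {0<..t} y \<le> indicator {0<..t} y * H (\<lambda>z. ennreal D * f z) y"
    proof (cases "y \<le> t")
      case True
      have "H f t \<le> H (\<lambda>z. ennreal D * f z) y"
        unfolding H_op_eq[OF t] H_op_eq[OF less_imp_le[OF y]]
      proof (rule nn_integral_mono)
        fix z
        have "ennreal (k z t) * f z \<le> ennreal (k z y) * (ennreal D * f z)" if "t \<le> z"
          using mult_right_mono[OF kernel_ge(1)[of y t z], of "f z"] True y that by (simp add: mult_ac)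
        then show "ennreal (k z t) * f z * indicator {t..} z \<le> ennreal (k z y) * (ennreal D * f z) * indicator {y..} z"
          using True by (auto split: split_indicator)
      qed
      then show ?thesis using True y by simp
    qed auto
  qed
  finally show ?thesis .
qed

text \<open>The same comparison with the other monotonicity: k(t,y) is at most D k(z,y) for all z
  \<ge> t.\<close>

lemma K_I_le:
  assumes f: "f \<in> Mplus" and t: "0 \<le> t"
  shows "K t * I f t \<le> T (\<lambda>z. ennreal D * f z) t"
proof -
  have ind: "(\<lambda>y. indicator {0<..t} y * ennreal (k t y)) \<in> Mplus"
    by (rule cut_Mplus[OF kernel_slice_Mplus(1)[OF k t]]) simp
  have "K t * I f t = Phi (\<lambda>y. I f t * (indicator {0<..t} y * ennreal (k t y)))"
    by (subst wnorm_cmult[OF q_pos w ind]) (rule mult.commute)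
  also have "\<dots> \<le> T (\<lambda>z. ennreal D * f z) t"
  proof (rule wnorm_mono[OF q_pos w])
    show "(\<lambda>y. I f t * (indicator {0<..t} y * ennreal (k t y))) \<in> Mplus" by (rule cmult_Mplus[OF ind])
    fix y :: real assume y: "0 < y"
    show "I f t * (indicator {0<..t} y * ennreal (k t y)) \<le> indicator {0<..t} y * H (\<lambda>z. ennreal D * f z) y"
    proof (cases "y \<le> t")
      case True
      note [measurable] = f
      have "I f t * ennreal (k t y) = (\<integral>\<^sup>+z. ennreal (k t y) * (f z * indicator {t..} z) \<partial>HL)"
        unfolding I_eq[OF t] by (simp add: nn_integral_cmult mult.commute)
      also have "\<dots> \<le> H (\<lambda>z. ennreal D * f z) y"
        unfolding H_op_eq[OF less_imp_le[OF y]]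
      proof (rule nn_integral_mono)
        fix z
        have "ennreal (k t y) * f z \<le> ennreal (k z y) * (ennreal D * f z)" if "t \<le> z"
          using mult_right_mono[OF kernel_ge(2)[of y t z], of "f z"] True y that by (simp add: mult_ac)
        then show "ennreal (k t y) * (f z * indicator {t..} z) \<le> ennreal (k z y) * (ennreal D * f z) * indicator {y..} z"
          using True by (auto split: split_indicator)
      qed
      finally show ?thesis using True y by simp
    qed auto
  qed
  finally show ?thesis .
qed

lemma LT_bound: "CT < top \<Longrightarrow> f \<in> Mplus \<Longrightarrow> N f < top \<Longrightarrow> LT f \<le> CT * N f"
  unfolding CT_eq by (rule least_const_bound)

lemma LT_scaled_bound:
  assumes "CT < top" "f \<in> Mplus" "N f < top"
  shows "LT (\<lambda>z. ennreal D * f z) \<le> ennreal D * CT * N f"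
proof -
  have N: "N (\<lambda>z. ennreal D * f z) = ennreal D * N f"
    by (rule wnorm_cmult) (use p_pos v assms in auto)
  have "LT (\<lambda>z. ennreal D * f z) \<le> CT * N (\<lambda>z. ennreal D * f z)"
    by (rule LT_bound) (use assms cmult_Mplus in \<open>auto simp: N ennreal_mult_less_top\<close>)
  then show ?thesis by (simp add: N mult_ac)
qed

lemma A0_le:
  assumes "CT < top"
  shows "A0 p q r u v w k \<le> ennreal D * CT"
  unfolding A0_eq
proof (rule least_const_le)
  fix f assume f: "f \<in> Mplus" "N f < top"
  have "(\<integral>\<^sup>+t. u t * W t epowr r * H f t epowr r \<partial>HL) epowr (1 / r) \<le> LT (\<lambda>z. ennreal D * f z)"
    using r_pos by (intro epowr_mono nn_integral_mono)
      (auto simp: mult.assoc epowr_mult[symmetric] intro!: mult_left_mono epowr_mono W_H_le f)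
  also have "\<dots> \<le> ennreal D * CT * N f" by (rule LT_scaled_bound[OF assms f])
  finally show "(\<integral>\<^sup>+t. u t * W t epowr r * H f t epowr r \<partial>HL) epowr (1 / r) \<le> ennreal D * CT * N f" .
qed

lemma A1_le:
  assumes "CT < top"
  shows "A1 p q r u v w k \<le> ennreal D * CT"
  unfolding A1_eq
proof (rule least_const_le)
  fix f assume f: "f \<in> Mplus" "N f < top"
  have "(\<integral>\<^sup>+t. u t * K t epowr r * I f t epowr r \<partial>HL) epowr (1 / r) \<le> LT (\<lambda>z. ennreal D * f z)"
    using r_pos by (intro epowr_mono nn_integral_mono)
      (auto simp: mult.assoc epowr_mult[symmetric] intro!: mult_left_mono epowr_mono K_I_le f)
  also have "\<dots> \<le> ennreal D * CT * N f" by (rule LT_scaled_bound[OF assms f])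
  finally show "(\<integral>\<^sup>+t. u t * K t epowr r * I f t epowr r \<partial>HL) epowr (1 / r) \<le> ennreal D * CT * N f" .
qed

end

section \<open>Bounding A2 by C_T\<close>

lemma SUP_epowr_le_sum:
  fixes h :: "'a \<Rightarrow> ennreal"
  assumes "finite S" "0 < a"
  shows "(SUP j\<in>S. h j) epowr a \<le> (\<Sum>j\<in>S. h j epowr a)"
  unfolding epowr_le_swap[OF assms(2)]
proof (rule SUP_least)
  fix j assume "j \<in> S"
  then have "h j epowr a \<le> (\<Sum>j\<in>S. h j epowr a)"
    using assms(1) by (intro member_le_sum) auto
  then show "h j \<le> (\<Sum>j\<in>S. h j epowr a) epowr (1 / a)"
    by (simp add: epowr_le_swap[OF assms(2)])
qed

lemma (in levels) indicator_block:
  assumes "x i < t" "t \<le> x (i + 1)"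
  shows "indicator {x j<..x (j + 1)} t = (if j = i then 1 else 0 :: ennreal)"
proof (cases "j = i")
  case False
  then have "t \<notin> {x j<..x (j + 1)}" using block_unique[of j t i] assms by auto
  then show ?thesis using False by simp
qed (use assms in simp)

context iterated
begin

abbreviation M :: "real \<Rightarrow> ennreal" where
  "M t \<equiv> op_norm (ennreal p) v q w (H_cut k t)"

lemma H_cut_eq: "Phi (H_cut k t f) = T f t"
  by (simp add: H_cut_def[abs_def])

lemma M_eq: "M t = least_const (ennreal p) v (\<lambda>f. T f t)"
  by (simp add: op_norm_def H_cut_eq)

lemma M_zero: "M 0 = 0"
proof -
  have "M 0 \<le> 0"
    unfolding M_eq
  proof (rule least_const_le)
    fix f
    have "T f 0 = Phi (\<lambda>y. 0 * 0)" by simp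
    also have "\<dots> = 0" using wnorm_cmult[OF q_pos w zero_Mplus, of 0] by simp
    finally show "T f 0 \<le> 0 * N f" by simp
  qed
  then show ?thesis by simp
qed

lemma T_mono:
  assumes "f \<in> Mplus" "s \<le> t" "\<And>z. f z \<le> g z"
  shows "T f s \<le> T g t"
  by (rule wnorm_mono[OF q_pos w cut_H_Mplus[OF assms(1)]])
    (use assms in \<open>auto split: split_indicator intro!: H_op_mono\<close>)

lemma T_cmult:
  assumes "f \<in> Mplus"
  shows "T (\<lambda>z. c * f z) t = c * T f t"
proof -
  have "T (\<lambda>z. c * f z) t = Phi (\<lambda>y. c * (indicator {0<..t} y * H f y))"
    by (rule wnorm_cong[OF q_pos w])
      (auto intro!: cut_H_Mplus cmult_Mplus assms simp: H_op_cmult[OF k assms] mult.left_commute)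
  then show ?thesis using wnorm_cmult[OF q_pos w cut_H_Mplus[OF assms]] by simp
qed

text \<open>Since \<open>T f\<close> increases, restricting the outer integral to {t..} leaves at
  least \<open>tail u t * T f t epowr r\<close>. The tail is positive and finite, so its root can be
  divided out.\<close>

lemma tail_M_le:
  assumes "CT < top" "0 < t"
  shows "tail u t epowr (1 / r) * M t \<le> CT"
proof -
  obtain U where U: "tail u t = ennreal U" "0 < U"
    using tail_finite[OF assms(2)] tail_pos[OF assms(2)] by (cases "tail u t") auto
  define c where "c = U powr (1 / r)"
  have c: "tail u t epowr (1 / r) = ennreal c" "0 < c" using U by (auto simp: c_def)
  have cc: "ennreal c * ennreal (1 / c) = 1" "ennreal (1 / c) * ennreal c = 1"
    using c by (auto simp flip: ennreal_mult)
  note [measurable] = u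
  have sets: "{t..} \<in> sets HL" using assms(2) by (auto simp: sets_restrict_space_iff)
  have tail: "tail u t = (\<integral>\<^sup>+s. u s * indicator {t..} s \<partial>HL)"
    using assms(2) sets by (simp add: tail_eq_emeasure(1)[OF u] emeasure_density)
  have "M t \<le> ennreal (1 / c) * CT"
    unfolding M_eq
  proof (rule least_const_le)
    fix f assume f: "f \<in> Mplus" "N f < top"
    have "(\<integral>\<^sup>+s. u s * indicator {t..} s * T f t epowr r \<partial>HL) \<le> (\<integral>\<^sup>+s. u s * T f s epowr r \<partial>HL)"
      using r_pos by (intro nn_integral_mono)
        (auto split: split_indicator intro!: mult_left_mono epowr_mono T_mono f)
    also have "(\<integral>\<^sup>+s. u s * indicator {t..} s * T f t epowr r \<partial>HL) = tail u t * T f t epowr r"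
      unfolding tail by (rule nn_integral_multc) (use sets in measurable)
    finally have "(tail u t * T f t epowr r) epowr (1 / r) \<le> LT f"
      using r_pos by (intro epowr_mono) auto
    also have "\<dots> \<le> CT * N f" by (rule LT_bound[OF assms(1) f])
    finally have "ennreal c * T f t \<le> CT * N f"
      using r_pos c by (simp add: epowr_mult epowr_inverse)
    then have "ennreal (1 / c) * (ennreal c * T f t) \<le> ennreal (1 / c) * (CT * N f)"
      by (rule mult_left_mono) simp
    then show "T f t \<le> ennreal (1 / c) * CT * N f"
      by (simp add: mult.assoc[symmetric] cc)
  qed
  then have "ennreal c * M t \<le> ennreal c * (ennreal (1 / c) * CT)"
    by (rule mult_left_mono) simp
  then show ?thesis by (simp add: c mult.assoc[symmetric] cc)
qed

lemma A2_le_1: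
  assumes "CT < top" "p \<le> r"
  shows "A2 p q r u v w k \<le> CT"
  using assms by (auto simp: A2_def intro!: SUP_least tail_M_le)

lemma M_less_top:
  assumes "CT < top" "0 \<le> t"
  shows "M t < top"
proof (cases "t = 0")
  case False
  with assms have t: "0 < t" by simp
  have "tail u t epowr (1 / r) * M t < top"
    using tail_M_le[OF assms(1) t] assms(1) by simp
  moreover have "tail u t epowr (1 / r) \<noteq> 0" using tail_pos[OF t] by simp
  ultimately show ?thesis
    by (cases "M t") (auto simp: ennreal_mult_top)
qed (simp add: M_zero)

text \<open>
  The test function is a maximum rather than a sum, so the supports of the near-extremal
  functions need not be disjoint.
\<close>

lemma finite_block_sum_le:
  assumes CT: "CT < top" and rp: "r < p" and S: "finite S" and s: "1 / s = 1 / r - 1 / p" "0 < s"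
  shows "(\<Sum>j\<in>S. ennreal (l j) epowr (s / r) * M (x (j + 2)) epowr s)
    \<le> (ennreal (16 * 2 powr r) * CT epowr r) epowr (s / r)"
proof -
  \<comment> \<open>The exponent in a makes both \<open>a j epowr p\<close> and
    \<open>b j * a j epowr r\<close> equal to \<open>b j epowr (s / r)\<close>: what block j costs
    in the norm of f and what it contributes to the left-hand side are, up to constants, the same
    summand of Z.\<close>
  define b where "b j = ennreal (l j) * M (x (j + 2)) epowr r" for j
  define a where "a j = b j epowr (s / (r * p))" for j
  define Z where "Z = (\<Sum>j\<in>S. b j epowr (s / r))"
  have exps: "s / p + 1 = s / r" "r / s + r / p = 1"
    using s r_pos p_pos by (auto simp: field_simps)
  have b_fin: "b j < top" for j
    using M_less_top[OF CT x_nonneg] by (simp add: b_def ennreal_mult_less_top)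
  have "\<exists>g\<in>Mplus. N g \<le> 1 \<and> M (x (j + 2)) / 2 \<le> T g (x (j + 2))" for j
    unfolding M_eq
    by (rule near_extremal) (use M_less_top[OF CT x_nonneg] p_pos v T_cmult in \<open>auto simp: M_eq\<close>)
  then obtain g where g: "\<And>j. g j \<in> Mplus" "\<And>j. N (g j) \<le> 1"
    "\<And>j. M (x (j + 2)) / 2 \<le> T (g j) (x (j + 2))"
    by metis
  note [measurable] = g(1) v u
  define f where "f z = (SUP j\<in>S. a j * g j z)" for z
  have f: "f \<in> Mplus"
    unfolding f_def[abs_def] using S by (intro MplusI borel_measurable_SUP) (auto intro: countable_finite)
  have ap: "a j epowr p = b j epowr (s / r)" for j
    using p_pos by (simp add: a_def epowr_epowr)
  have "N f epowr p = (\<integral>\<^sup>+z. f z epowr p * v z \<partial>HL)"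
    using p_pos by (rule wnorm_epowr)
  also have "\<dots> \<le> (\<integral>\<^sup>+z. (\<Sum>j\<in>S. a j epowr p * (g j z epowr p * v z)) \<partial>HL)"
  proof (rule nn_integral_mono)
    fix z
    have "f z epowr p * v z \<le> (\<Sum>j\<in>S. (a j * g j z) epowr p) * v z"
      unfolding f_def by (intro mult_right_mono SUP_epowr_le_sum S p_pos) simp
    then show "f z epowr p * v z \<le> (\<Sum>j\<in>S. a j epowr p * (g j z epowr p * v z))"
      by (simp add: epowr_mult sum_distrib_right mult.assoc)
  qed
  also have "\<dots> = (\<Sum>j\<in>S. a j epowr p * N (g j) epowr p)"
    using p_pos by (simp add: nn_integral_sum nn_integral_cmult wnorm_epowr)
  also have "\<dots> \<le> (\<Sum>j\<in>S. a j epowr p * 1 epowr p)"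
    using p_pos g(2) by (intro sum_mono mult_left_mono epowr_mono) auto
  also have "\<dots> = Z" by (simp add: Z_def ap)
  finally have Nf: "N f \<le> Z epowr (1 / p)" using p_pos by (simp add: epowr_le_swap)
  \<comment> \<open>Here finiteness of S is used: a power of Z is divided out at the end.\<close>
  have Z_fin: "Z < top" using b_fin S by (simp add: Z_def)
  have Nf_fin: "N f < top" using Nf Z_fin by (simp add: le_less_trans)
  \<comment> \<open>Each g j is nearly extremal for the cut at \<open>x (j + 2)\<close>, so it
    bounds \<open>T f t\<close> from below for all t beyond that point, in particular on block j +
    2. These blocks are disjoint, so their contributions add up.\<close>
  let ?c = "\<lambda>j. (a j * (M (x (j + 2)) / 2)) epowr r"
  have "(\<Sum>j\<in>S. mass (j + 2) * ?c j)
    = (\<integral>\<^sup>+t. (\<Sum>j\<in>S. u t * indicator {x (j + 2)<..x (j + 2 + 1)} t * ?c j) \<partial>HL)"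
    by (simp add: nn_integral_sum nn_integral_multc mass_def)
  also have "\<dots> \<le> (\<integral>\<^sup>+t. u t * T f t epowr r \<partial>HL)"
  proof (rule nn_integral_mono)
    fix t
    show "(\<Sum>j\<in>S. u t * indicator {x (j + 2)<..x (j + 2 + 1)} t * ?c j) \<le> u t * T f t epowr r"
    proof (cases "\<exists>i\<in>S. t \<in> {x (i + 2)<..x (i + 2 + 1)}")
      case False
      then have "(\<Sum>j\<in>S. u t * indicator {x (j + 2)<..x (j + 2 + 1)} t * ?c j) = 0"
        by (intro sum.neutral) (auto split: split_indicator)
      then show ?thesis by simp
    next
      case True
      then obtain i where i: "i \<in> S" "x (i + 2) < t" "t \<le> x (i + 2 + 1)" by auto
      have "(\<Sum>j\<in>S. u t * indicator {x (j + 2)<..x (j + 2 + 1)} t * ?c j)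
        = (\<Sum>j\<in>S. if j = i then u t * ?c i else 0)"
      proof (rule sum.cong)
        fix j
        show "u t * indicator {x (j + 2)<..x (j + 2 + 1)} t * ?c j = (if j = i then u t * ?c i else 0)"
          unfolding indicator_block[OF i(2,3)] by simp
      qed simp
      also have "\<dots> = u t * ?c i" using i S by simp
      also have "\<dots> \<le> u t * T f t epowr r"
      proof (intro mult_left_mono epowr_mono)
        have "a i * (M (x (i + 2)) / 2) \<le> a i * T (g i) (x (i + 2))"
          by (intro mult_left_mono g) simp
        also have "\<dots> = T (\<lambda>z. a i * g i z) (x (i + 2))" by (simp add: T_cmult g)
        also have "\<dots> \<le> T f t"
          using i by (intro T_mono cmult_Mplus g) (auto simp: f_def intro: SUP_upper)
        finally show "a i * (M (x (i + 2)) / 2) \<le> T f t" .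
      qed (use r_pos in auto)
      finally show ?thesis .
    qed
  qed
  also have "\<dots> = LT f epowr r" using r_pos by (simp add: epowr_inverse)
  also have "\<dots> \<le> (CT * Z epowr (1 / p)) epowr r"
    using r_pos by (intro epowr_mono order_trans[OF LT_bound[OF CT f Nf_fin] mult_left_mono[OF Nf]]) auto
  also have "\<dots> = CT epowr r * Z epowr (r / p)"
    by (simp add: epowr_mult epowr_epowr)
  finally have upper: "(\<Sum>j\<in>S. mass (j + 2) * ?c j) \<le> CT epowr r * Z epowr (r / p)" .
  \<comment> \<open>Block j + 2 has mass at least \<open>l (j + 2) / 4 = l j / 16\<close>; the
    factor 2^r undoes the half in the near-extremality.\<close>
  have lower: "b j epowr (s / r) \<le> ennreal (16 * 2 powr r) * (mass (j + 2) * ?c j)" for j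
  proof (cases "x (j + 2) = 0")
    case True
    then show ?thesis by (simp add: b_def M_zero)
  next
    case False
    then have "0 < x (j + 2)" using x_nonneg[of "j + 2"] by linarith
    then have "0 < x (j + 2 + 1)" using x_mono[of "j + 2"] by linarith
    then have m: "ennreal (l (j + 2) / 4) \<le> mass (j + 2)" by (rule mass_ge)
    have l2: "l j = 16 * (l (j + 2) / 4)" using l_add[of j 2] by (simp add: powr_minus)
    have half: "M (x (j + 2)) / 2 = ennreal (1 / 2) * M (x (j + 2))"
      by (simp add: divide_ennreal_def inverse_ennreal mult.commute)
    have "b j epowr (s / r) = b j * b j epowr (s / p)"
      using epowr_add[of "b j" 1 "s / p"] exps by (simp add: add.commute)
    also have "b j epowr (s / p) = a j epowr r"
      using r_pos by (simp add: a_def epowr_epowr)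
    also have "b j * a j epowr r = ennreal (l j) * (a j * M (x (j + 2))) epowr r"
      by (simp add: b_def epowr_mult mult_ac)
    also have "ennreal (l j) = 16 * ennreal (l (j + 2) / 4)"
      unfolding l2 by (subst ennreal_mult) (auto simp: less_imp_le)
    also have "(a j * M (x (j + 2))) epowr r = ennreal (2 powr r) * ?c j"
    proof -
      have "ennreal (2 powr r) * ennreal ((1 / 2) powr r) = 1"
        by (simp add: powr_divide flip: ennreal_mult)
      then have "ennreal (2 powr r) * (ennreal ((1 / 2) powr r) * X) = X" for X
        by (metis mult.assoc mult_1)
      then show ?thesis unfolding half
        by (simp only: epowr_mult mult.left_commute epowr_ennreal zero_le_divide_1_iff zero_le_numeral)
    qed
    also have "16 * ennreal (l (j + 2) / 4) * (ennreal (2 powr r) * ?c j)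
      \<le> 16 * mass (j + 2) * (ennreal (2 powr r) * ?c j)"
      using m by (intro mult_right_mono mult_left_mono) auto
    also have "\<dots> = ennreal (16 * 2 powr r) * (mass (j + 2) * ?c j)"
      by (simp add: ennreal_mult mult_ac)
    finally show ?thesis .
  qed
  have "Z \<le> ennreal (16 * 2 powr r) * (\<Sum>j\<in>S. mass (j + 2) * ?c j)"
    unfolding Z_def sum_distrib_left by (intro sum_mono lower)
  also have "\<dots> \<le> ennreal (16 * 2 powr r) * (CT epowr r * Z epowr (r / p))"
    by (intro mult_left_mono upper) simp
  finally have Z_le: "Z \<le> ennreal (16 * 2 powr r) * CT epowr r * Z epowr (r / p)"
    by (simp add: mult.assoc)
  \<comment> \<open>Absorption: as 1 - r / p = r / s, dividing by the finite positive
    \<open>Z epowr (r / p)\<close> leaves \<open>Z epowr (r / s)\<close>.\<close>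
  have "Z \<le> (ennreal (16 * 2 powr r) * CT epowr r) epowr (s / r)"
  proof (cases "Z = 0")
    case False
    then obtain \<zeta> where \<zeta>: "Z = ennreal \<zeta>" "0 < \<zeta>" using Z_fin by (cases Z) auto
    obtain X where X: "ennreal (16 * 2 powr r) * CT epowr r = ennreal X" "0 \<le> X"
    proof -
      have "ennreal (16 * 2 powr r) * CT epowr r < top" using CT by (simp add: ennreal_mult_less_top)
      then show ?thesis using that by (cases "ennreal (16 * 2 powr r) * CT epowr r") auto
    qed
    have "\<zeta> \<le> X * \<zeta> powr (r / p)"
      using Z_le X \<zeta> by (simp add: ennreal_le_iff flip: ennreal_mult)
    moreover have "\<zeta> = \<zeta> powr (r / s) * \<zeta> powr (r / p)"
      using \<zeta> exps by (simp flip: powr_add)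
    ultimately have "\<zeta> powr (r / s) * \<zeta> powr (r / p) \<le> X * \<zeta> powr (r / p)" by linarith
    then have "\<zeta> powr (r / s) \<le> X" using \<zeta> by simp
    then have "(\<zeta> powr (r / s)) powr (s / r) \<le> X powr (s / r)"
      using s r_pos by (intro powr_mono2) auto
    then have "\<zeta> \<le> X powr (s / r)" using \<zeta> s r_pos by (simp add: powr_powr)
    then show ?thesis using X \<zeta> by (simp add: ennreal_leI)
  qed simp
  moreover have "Z = (\<Sum>j\<in>S. ennreal (l j) epowr (s / r) * M (x (j + 2)) epowr s)"
    unfolding Z_def b_def using r_pos by (simp add: epowr_mult epowr_epowr)
  ultimately show ?thesis by simp
qed

text \<open>By \<open>zeta_bounds\<close> the block operator is supported in (0,
  \<open>x (j + 2)\<close>], and it integrates over less than the cut operator. This is the origin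
  of the shift by 2.\<close>

lemma block_norm_le_M:
  assumes "x j < t" "t \<le> x (j + 1)"
  shows "op_norm (ennreal p) v q w (H_block k u (zeta_inv u t) (zeta u t)) \<le> M (x (j + 2))"
  unfolding op_norm_def
proof (rule least_const_mono)
  fix f assume f: "f \<in> Mplus"
  let ?g = "\<lambda>z. indicator {..zeta u (zeta u t)} z * f z"
  have g: "?g \<in> Mplus" by (rule cut_Mplus[OF f]) simp
  show "Phi (H_block k u (zeta_inv u t) (zeta u t) f) \<le> Phi (H_cut k (x (j + 2)) f)"
  proof (rule wnorm_mono[OF q_pos w])
    show "H_block k u (zeta_inv u t) (zeta u t) f \<in> Mplus"
      unfolding H_block_eq[abs_def] by (rule cut_H_Mplus[OF g])
    fix y :: real assume "0 < y"
    then show "H_block k u (zeta_inv u t) (zeta u t) f y \<le> H_cut k (x (j + 2)) f y"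
      unfolding H_block_eq H_cut_def
      using zeta_bounds[OF assms] by (intro mult_mono H_op_mono) (auto split: split_indicator)
  qed
qed

lemma s_exp_props:
  assumes "r < p"
  shows "1 / s_exp p r = 1 / r - 1 / p" "0 < s_exp p r"
proof -
  have "1 / p < 1 / r" using assms r_pos by (simp add: frac_less2)
  then show "1 / s_exp p r = 1 / r - 1 / p" "0 < s_exp p r" by (simp_all add: s_exp_def)
qed

text \<open>On block j the tail contributes \<open>l j\<close> to the power s / p and the mass one
  more factor \<open>l j\<close>; together this is the power s / r, the summand bounded uniformly
  over finite sets by \<open>finite_block_sum_le\<close>. The block norm is compared pointwise with
  a function constant on blocks, which avoids its measurability in t.\<close>

lemma A2_le_2:
  assumes CT: "CT < top" and rp: "r < p"
  shows "A2 p q r u v w k \<le> ennreal (16 * 2 powr r) epowr (1 / r) * CT"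
proof -
  define s where "s = s_exp p r"
  have s: "1 / s = 1 / r - 1 / p" "0 < s" using s_exp_props[OF rp] by (auto simp: s_def)
  have exps: "s / p + 1 = s / r" using s r_pos p_pos by (auto simp: field_simps)
  note [measurable] = u
  let ?B = "\<lambda>t. op_norm (ennreal p) v q w (H_block k u (zeta_inv u t) (zeta u t))"
  let ?c = "\<lambda>j. ennreal (l j) epowr (s / p) * M (x (j + 2)) epowr s"
  have "(\<integral>\<^sup>+t. u t * tail u t epowr (s / p) * ?B t epowr s \<partial>HL)
    \<le> (\<integral>\<^sup>+t. int_sum (\<lambda>j. u t * indicator {x j<..x (j + 1)} t * ?c j) \<partial>HL)"
  proof (rule nn_integral_mono_AE, use AE_HL_pos in eventually_elim)
    case (elim t)
    obtain j where j: "x j < t" "t \<le> x (j + 1)" using cover[OF elim] .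
    have "u t * tail u t epowr (s / p) * ?B t epowr s \<le> u t * ennreal (l j) epowr (s / p) * M (x (j + 2)) epowr s"
      using s p_pos by (intro mult_mono epowr_mono tail_block(2)[OF j] block_norm_le_M[OF j]) auto
    also have "\<dots> = u t * indicator {x j<..x (j + 1)} t * ?c j" using j by (simp add: mult.assoc)
    also have "\<dots> \<le> int_sum (\<lambda>j. u t * indicator {x j<..x (j + 1)} t * ?c j)"
      by (rule int_sum_upper)
    finally show ?case .
  qed
  also have "\<dots> = int_sum (\<lambda>j. \<integral>\<^sup>+t. u t * indicator {x j<..x (j + 1)} t * ?c j \<partial>HL)"
    by (rule nn_integral_count_space_nn_integral) auto
  also have "\<dots> = int_sum (\<lambda>j. mass j * ?c j)"
    by (simp add: nn_integral_multc mass_def)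
  also have "\<dots> \<le> int_sum (\<lambda>j. ennreal (l j) epowr (s / r) * M (x (j + 2)) epowr s)"
  proof (rule nn_integral_mono)
    fix j
    have "mass j * ?c j \<le> ennreal (l j) * ?c j" by (intro mult_right_mono mass_le) simp
    also have "\<dots> = ennreal (l j) epowr (s / r) * M (x (j + 2)) epowr s"
      using epowr_add[of "ennreal (l j)" 1 "s / p"] exps
      by (simp only: epowr_one mult.assoc add.commute)
    finally show "mass j * ?c j \<le> ennreal (l j) epowr (s / r) * M (x (j + 2)) epowr s" .
  qed
  also have "\<dots> \<le> (ennreal (16 * 2 powr r) * CT epowr r) epowr (s / r)"
    by (rule int_sum_least) (rule finite_block_sum_le[OF CT rp _ s])
  finally have "(\<integral>\<^sup>+t. u t * tail u t epowr (s / p) * ?B t epowr s \<partial>HL) epowr (1 / s)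
    \<le> ((ennreal (16 * 2 powr r) * CT epowr r) epowr (s / r)) epowr (1 / s)"
    by (intro epowr_mono) (use s(2) in auto)
  also have "\<dots> = (ennreal (16 * 2 powr r) * CT epowr r) epowr (1 / r)"
    using s(2) by (simp add: epowr_epowr)
  also have "\<dots> = ennreal (16 * 2 powr r) epowr (1 / r) * CT"
    using r_pos by (simp only: epowr_mult epowr_inverse)
  finally show ?thesis using rp by (simp add: A2_def set_nn_integral_HL s_def)
qed

end

section \<open>Upper bound\<close>

text \<open>Superlevel sets are intervals. This serves \<open>W\<close>; the factor \<open>K\<close>
  increases only up to the constant D.\<close>

lemma mono_on_measurable_HL:
  fixes f :: "real \<Rightarrow> ennreal"
  assumes "mono f"
  shows "f \<in> borel_measurable HL"
proof -
  have "f \<in> borel_measurable borel"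
  proof (rule borel_measurableI_greater)
    fix y
    have "is_interval {x \<in> space borel. y < f x}"
      unfolding is_interval_1 using monoD[OF assms] by (auto intro: less_le_trans)
    then show "{x \<in> space borel. y < f x} \<in> sets borel"
      by (rule real_interval_borel_measurable)
  qed
  then show ?thesis by (rule measurable_compose[OF measurable_ident_HL])
qed

text \<open>Here \<open>g\<close> need not be measurable, so \<open>nn_integral_add\<close> does not apply.\<close>

lemma nn_integral_le_add:
  assumes [measurable]: "u \<in> borel_measurable M" "m \<in> borel_measurable M" "f \<in> borel_measurable M"
    and le: "AE t in M. m t \<le> f t + g t"
  shows "(\<integral>\<^sup>+t. u t * m t \<partial>M) \<le> (\<integral>\<^sup>+t. u t * f t \<partial>M) + (\<integral>\<^sup>+t. u t * g t \<partial>M)"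
proof -
  \<comment> \<open>A measurable substitute for g: m is at most f + d, and d is at most g almost
    everywhere. The case distinction prevents a difference of two infinite values.\<close>
  define d where "d t = (if f t = top then 0 else m t - f t)" for t
  have [measurable]: "d \<in> borel_measurable M" unfolding d_def[abs_def] by measurable
  have "(\<integral>\<^sup>+t. u t * m t \<partial>M) \<le> (\<integral>\<^sup>+t. u t * f t + u t * d t \<partial>M)"
  proof (rule nn_integral_mono)
    fix t
    have "m t \<le> f t + d t"
    proof (cases "f t \<le> m t")
      case True
      then show ?thesis by (simp add: d_def add_diff_inverse_ennreal)
    next
      case False
      then show ?thesis by (simp add: add_increasing2)
    qed
    then show "u t * m t \<le> u t * f t + u t * d t"
      by (metis distrib_left mult_left_mono zero_le)
  qed
  also have "\<dots> = (\<integral>\<^sup>+t. u t * f t \<partial>M) + (\<integral>\<^sup>+t. u t * d t \<partial>M)"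
    by (rule nn_integral_add) measurable
  also have "(\<integral>\<^sup>+t. u t * d t \<partial>M) \<le> (\<integral>\<^sup>+t. u t * g t \<partial>M)"
  proof (rule nn_integral_mono_AE, use le in eventually_elim)
    case (elim t)
    then have "d t \<le> g t" by (simp add: d_def ennreal_minus_le_iff)
    then show ?case by (rule mult_left_mono) simp
  qed
  finally show ?thesis by (simp add: add_left_mono)
qed

text \<open>Each term is at most the whole sum, so a - 1 of its powers can be replaced by powers of
  the sum. This is the embedding of l^1 into l^a.\<close>

lemma int_sum_epowr_le:
  assumes "1 \<le> a"
  shows "int_sum (\<lambda>j. f j epowr a) \<le> int_sum f epowr a"
proof -
  have split: "y epowr a = y * y epowr (a - 1)" for y
    using epowr_add[of y 1 "a - 1"] by simp
  have "int_sum (\<lambda>j. f j epowr a) \<le> int_sum (\<lambda>j. f j * int_sum f epowr (a - 1))"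
    unfolding split using assms by (intro nn_integral_mono mult_left_mono epowr_mono int_sum_upper) auto
  also have "\<dots> = int_sum f epowr a"
    unfolding split[of "int_sum f"] by (rule nn_integral_multc) simp
  finally show ?thesis .
qed

lemma (in levels) int_sum_block:
  assumes "x i < t" "t \<le> x (i + 1)"
  shows "int_sum (\<lambda>j. indicator {x j<..x (j + 1)} t * c j) = c i"
proof -
  have "int_sum (\<lambda>j. indicator {x j<..x (j + 1)} t * c j)
    = (\<Sum>j\<in>{i}. indicator {x j<..x (j + 1)} t * c j)"
    unfolding indicator_block[OF assms] by (rule nn_integral_count_space') auto
  then show ?thesis using assms by simp
qed

lemma (in levels) int_sum_block_shift:
  assumes "x (i + n) < t" "t \<le> x (i + n + 1)"
  shows "int_sum (\<lambda>j. indicator {x (j + n)<..x (j + n + 1)} t * c j) = c i"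
  using int_sum_shift[of "\<lambda>j. indicator {x j<..x (j + 1)} t * c (j - n)" n]
    int_sum_block[OF assms, of "\<lambda>j. c (j - n)"] by simp

section \<open>Reduction of the outer norm to block norms\<close>

context iterated
begin

abbreviation J :: "int \<Rightarrow> real set" where
  "J j \<equiv> {x j<..x (j + 1)}"

text \<open>The cut is at \<open>x (j + 2)\<close> and not at \<open>x (j + 1)\<close>: block j + 1
  stays free as the range of the intermediate points t. Below, \<open>P\<close> and \<open>E\<close>
  are the norms over block j of the near and the far part.\<close>

abbreviation f1 :: "(real \<Rightarrow> ennreal) \<Rightarrow> int \<Rightarrow> real \<Rightarrow> ennreal" where
  "f1 f j \<equiv> (\<lambda>z. indicator {..x (j + 2)} z * f z)"

abbreviation f2 :: "(real \<Rightarrow> ennreal) \<Rightarrow> int \<Rightarrow> real \<Rightarrow> ennreal" where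
  "f2 f j \<equiv> (\<lambda>z. indicator {x (j + 2)<..} z * f z)"

abbreviation B :: "(real \<Rightarrow> ennreal) \<Rightarrow> int \<Rightarrow> ennreal" where
  "B f j \<equiv> Phi (\<lambda>y. indicator (J j) y * H f y)"

abbreviation P :: "(real \<Rightarrow> ennreal) \<Rightarrow> int \<Rightarrow> ennreal" where
  "P f j \<equiv> B (f1 f j) j"

abbreviation E :: "(real \<Rightarrow> ennreal) \<Rightarrow> int \<Rightarrow> ennreal" where
  "E f j \<equiv> B (f2 f j) j"

lemma f12_Mplus: "f \<in> Mplus \<Longrightarrow> f1 f j \<in> Mplus" "f \<in> Mplus \<Longrightarrow> f2 f j \<in> Mplus"
  by (auto intro: cut_Mplus)

lemma B_empty:
  assumes "x (j + 1) = 0"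
  shows "B f j = 0"
proof -
  have "J j = {}" using assms x_nonneg[of j] by auto
  then have "B f j = Phi (\<lambda>y. 0 * 0)" by simp
  also have "\<dots> = 0" using wnorm_cmult[OF q_pos w zero_Mplus, of 0] by simp
  finally show ?thesis .
qed

text \<open>The block norms need not decay, so a growing weight is imposed: boundedness of the
  weighted sum forces the decay 2^(-(i-j)/(2r)) that \<open>wnorm_cut_le_blocks\<close> requires.
  The rate 1/2 must be positive for this, and below 1 to be beaten by the decay of the levels when
  the sum over i is taken.\<close>

lemma T_block_le:
  assumes f: "f \<in> Mplus" and t: "x i < t" "t \<le> x (i + 1)"
  shows "T f t epowr r \<le> block_const q (1 / (2 * r)) epowr r *
    int_sum (\<lambda>j. if j \<le> i then ennreal (2 powr (real_of_int (i - j) / 2)) * B f j epowr r else 0)"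
    (is "_ \<le> ?b epowr r * int_sum ?R")
proof -
  let ?\<rho> = "int_sum ?R epowr (1 / r)"
  have "T f t \<le> T f (x (i + 1))" by (rule T_mono[OF f t(2)]) simp
  also have "\<dots> \<le> ?b * ?\<rho>"
  proof (rule wnorm_cut_le_blocks[OF q_pos w H_Mplus[OF f] cover_below])
    fix j assume j: "j \<le> i"
    let ?e = "real_of_int (i - j) / (2 * r)"
    have "ennreal (2 powr (real_of_int (i - j) / 2)) * B f j epowr r \<le> int_sum ?R"
      using int_sum_upper[of ?R j] j by simp
    moreover have "ennreal (2 powr (real_of_int (i - j) / 2)) = ennreal (2 powr ?e) epowr r"
      using r_pos by (simp add: powr_powr)
    ultimately have "(ennreal (2 powr ?e) * B f j) epowr r \<le> int_sum ?R"
      by (simp only: epowr_mult)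
    then have "ennreal (2 powr ?e) * B f j \<le> ?\<rho>"
      using r_pos by (simp add: epowr_le_swap)
    then have "ennreal (2 powr (- ?e)) * (ennreal (2 powr ?e) * B f j) \<le> ennreal (2 powr (- ?e)) * ?\<rho>"
      by (rule mult_left_mono) simp
    moreover have "ennreal (2 powr (- ?e)) * ennreal (2 powr ?e) = 1"
      by (simp flip: ennreal_mult powr_add)
    ultimately have "B f j \<le> ennreal (2 powr (- ?e)) * ?\<rho>"
      by (simp add: mult.assoc[symmetric])
    moreover have "- ?e = - (1 / (2 * r)) * real_of_int (i - j)" by simp
    ultimately show "B f j \<le> ennreal (2 powr (- (1 / (2 * r)) * real_of_int (i - j))) * ?\<rho>"
      by metis
  qed (use r_pos in auto)
  finally have "T f t epowr r \<le> (?b * ?\<rho>) epowr r"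
    using r_pos by (intro epowr_mono) auto
  then show ?thesis using r_pos by (simp add: epowr_mult epowr_inverse)
qed

text \<open>A discrete Hardy inequality: after interchanging the sums, the level \<open>l i\<close>
  against the weight leaves for every j a geometric series of ratio 2^(-1/2).\<close>

lemma LT_le_blocks:
  assumes f: "f \<in> Mplus"
  shows "(\<integral>\<^sup>+t. u t * T f t epowr r \<partial>HL) \<le>
    block_const q (1 / (2 * r)) epowr r * geom (1 / 2) * int_sum (\<lambda>j. ennreal (l j) * B f j epowr r)"
proof -
  let ?b = "block_const q (1 / (2 * r)) epowr r"
  let ?R = "\<lambda>i j. if j \<le> i then ennreal (2 powr (real_of_int (i - j) / 2)) * B f j epowr r else 0"
  note [measurable] = u
  have "(\<integral>\<^sup>+t. u t * T f t epowr r \<partial>HL) \<le> (\<integral>\<^sup>+t. int_sum (\<lambda>i. u t * indicator (J i) t * (?b * int_sum (?R i))) \<partial>HL)"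
  proof (rule nn_integral_mono_AE, use AE_HL_pos in eventually_elim)
    case (elim t)
    obtain i where i: "x i < t" "t \<le> x (i + 1)" using cover[OF elim] .
    have "u t * T f t epowr r \<le> u t * (?b * int_sum (?R i))"
      by (intro mult_left_mono T_block_le[OF f i]) simp
    also have "\<dots> = u t * indicator (J i) t * (?b * int_sum (?R i))" using i by simp
    also have "\<dots> \<le> int_sum (\<lambda>i. u t * indicator (J i) t * (?b * int_sum (?R i)))"
      by (rule int_sum_upper)
    finally show ?case .
  qed
  also have "\<dots> = int_sum (\<lambda>i. \<integral>\<^sup>+t. u t * indicator (J i) t * (?b * int_sum (?R i)) \<partial>HL)"
    by (rule nn_integral_count_space_nn_integral) auto
  also have "\<dots> = int_sum (\<lambda>i. mass i * (?b * int_sum (?R i)))"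
    by (simp add: nn_integral_multc mass_def)
  also have "\<dots> \<le> int_sum (\<lambda>i. ennreal (l i) * (?b * int_sum (?R i)))"
    by (intro nn_integral_mono mult_right_mono mass_le) simp
  also have "\<dots> = ?b * int_sum (\<lambda>i. int_sum (\<lambda>j. ennreal (l i) * ?R i j))"
    by (simp add: nn_integral_cmult mult.left_commute[of _ ?b])
  also have "int_sum (\<lambda>i. int_sum (\<lambda>j. ennreal (l i) * ?R i j)) = int_sum (\<lambda>j. int_sum (\<lambda>i. ennreal (l i) * ?R i j))"
    by (rule int_sum_swap)
  also have "\<dots> = int_sum (\<lambda>j. geom (1 / 2) * (ennreal (l j) * B f j epowr r))"
  proof (rule nn_integral_cong)
    fix j
    have "ennreal (l i) * ?R i j
      = (if j \<le> i then ennreal (2 powr (- (1 / 2) * real_of_int (i - j))) else 0) * (ennreal (l j) * B f j epowr r)" for i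
    proof -
      have "2 powr (- a) * 2 powr (a / 2) = 2 powr (- (1 / 2) * a)" for a :: real
        by (simp add: powr_add[symmetric])
      moreover have "l i = l j * 2 powr (- real_of_int (i - j))"
        using l_add[of j "i - j"] by simp
      ultimately have "l i * 2 powr (real_of_int (i - j) / 2) = 2 powr (- (1 / 2) * real_of_int (i - j)) * l j"
        by (metis mult.assoc mult.commute)
      then have "ennreal (l i) * ennreal (2 powr (real_of_int (i - j) / 2)) = ennreal (2 powr (- (1 / 2) * real_of_int (i - j))) * ennreal (l j)"
        by (simp add: less_imp_le flip: ennreal_mult)
      then show ?thesis by (simp add: mult.assoc[symmetric])
    qed
    then show "int_sum (\<lambda>i. ennreal (l i) * ?R i j) = geom (1 / 2) * (ennreal (l j) * B f j epowr r)"
      by (simp only: nn_integral_multc borel_measurable_count_space int_sum_geom_ge)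
  qed
  also have "\<dots> = geom (1 / 2) * int_sum (\<lambda>j. ennreal (l j) * B f j epowr r)"
    by (rule nn_integral_cmult) simp
  finally show ?thesis by (simp add: mult.assoc)
qed

lemma B_le:
  assumes f: "f \<in> Mplus"
  shows "B f j epowr r \<le> quasi q epowr r * ennreal (2 powr r) * (P f j epowr r + E f j epowr r)"
proof -
  have split: "f = (\<lambda>z. f1 f j z + f2 f j z)" by (auto simp: fun_eq_iff split: split_indicator)
  have "B f j = Phi (\<lambda>y. indicator (J j) y * H (f1 f j) y + indicator (J j) y * H (f2 f j) y)"
  proof (rule wnorm_cong[OF q_pos w cut_H_Mplus[OF f]])
    show "(\<lambda>y. indicator (J j) y * H (f1 f j) y + indicator (J j) y * H (f2 f j) y) \<in> Mplus"
      using cut_H_Mplus[OF f12_Mplus(1)[OF f]] cut_H_Mplus[OF f12_Mplus(2)[OF f]] by (auto simp: Mplus_def)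
    fix y :: real assume "0 < y"
    then have "H f y = H (f1 f j) y + H (f2 f j) y"
      by (subst split) (rule H_op_add[OF k f12_Mplus[OF f]], simp)
    then show "indicator (J j) y * H f y = indicator (J j) y * H (f1 f j) y + indicator (J j) y * H (f2 f j) y"
      by (simp add: distrib_left)
  qed
  also have "\<dots> \<le> quasi q * (P f j + E f j)"
    by (intro wnorm_add_le q_pos w cut_H_Mplus f12_Mplus f)
  finally have "B f j epowr r \<le> (quasi q * (P f j + E f j)) epowr r"
    using r_pos by (intro epowr_mono) auto
  also have "\<dots> \<le> quasi q epowr r * (ennreal (2 powr r) * (P f j epowr r + E f j epowr r))"
    unfolding epowr_mult using r_pos by (intro mult_left_mono epowr_add_le) auto
  finally show ?thesis by (simp add: mult.assoc)
qed

section \<open>The far part\<close>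

definition cE :: ennreal where
  "cE = (ennreal D * quasi q) epowr r * ennreal (2 powr r)"

text \<open>Every t in block j + 1 separates y in block j from z beyond \<open>x (j + 2)\<close>, so
  it is admissible as intermediate point of the kernel inequality. The left-hand side is independent
  of t.\<close>

lemma E_le:
  assumes f: "f \<in> Mplus" and t: "x (j + 1) < t" "t \<le> x (j + 1 + 1)"
  shows "E f j epowr r \<le> cE * ((W t * H f t) epowr r + (K t * I f t) epowr r)"
proof -
  have t0: "0 \<le> t" using t x_nonneg[of "j + 1"] by linarith
  have t2: "t \<le> x (j + 2)" using t(2) by (simp add: add.assoc)
  note [measurable] = f kernel_slice_Mplus(2)[OF k t0]
  have W: "(\<lambda>y. indicator {0<..t} y) \<in> Mplus" using cut_Mplus[OF one_Mplus, of "{0<..t}"] by simp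
  have K: "(\<lambda>y. indicator {0<..t} y * ennreal (k t y)) \<in> Mplus"
    by (rule cut_Mplus[OF kernel_slice_Mplus(1)[OF k t0]]) simp
  have "E f j \<le> Phi (\<lambda>y. ennreal D * (H f t * indicator {0<..t} y + I f t * (indicator {0<..t} y * ennreal (k t y))))"
  proof (rule wnorm_mono[OF q_pos w cut_H_Mplus[OF f12_Mplus(2)[OF f]]])
    fix y :: real assume y: "0 < y"
    show "indicator (J j) y * H (f2 f j) y \<le>
      ennreal D * (H f t * indicator {0<..t} y + I f t * (indicator {0<..t} y * ennreal (k t y)))"
    proof (cases "y \<in> J j")
      case True
      then have yt: "y \<le> t" using t by simp
      have "H (f2 f j) y \<le> (\<integral>\<^sup>+z. ennreal D * (ennreal (k z t) * f z * indicator {t..} z + ennreal (k t y) * (f z * indicator {t..} z)) \<partial>HL)"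
        unfolding H_op_eq[OF less_imp_le[OF y]]
      proof (rule nn_integral_mono)
        fix z
        show "ennreal (k z y) * (indicator {x (j + 2)<..} z * f z) * indicator {y..} z
          \<le> ennreal D * (ennreal (k z t) * f z * indicator {t..} z + ennreal (k t y) * (f z * indicator {t..} z))"
        proof (cases "x (j + 2) < z")
          case True
          then have "t \<le> z" using t2 by simp
          then have "ennreal (k z y) * f z \<le> ennreal D * (ennreal (k z t) + ennreal (k t y)) * f z"
            using y yt by (intro mult_right_mono kernel_ge(3)) auto
          also have "\<dots> = ennreal D * (ennreal (k z t) * f z + ennreal (k t y) * f z)"
            by (simp only: distrib_right mult.assoc)
          finally show ?thesis using True \<open>t \<le> z\<close> yt by simp
        qed simp
      qed
      also have "\<dots> = ennreal D * (H f t + ennreal (k t y) * I f t)"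
        unfolding H_op_eq[OF t0] I_eq[OF t0] by (simp add: nn_integral_cmult nn_integral_add)
      finally show ?thesis using True y yt by (simp add: mult.commute)
    qed simp
  qed
  also have "\<dots> = ennreal D * Phi (\<lambda>y. H f t * indicator {0<..t} y + I f t * (indicator {0<..t} y * ennreal (k t y)))"
    by (rule wnorm_cmult[OF q_pos w]) (use W K in \<open>auto simp: Mplus_def\<close>)
  also have "\<dots> \<le> ennreal D * (quasi q * (Phi (\<lambda>y. H f t * indicator {0<..t} y) + Phi (\<lambda>y. I f t * (indicator {0<..t} y * ennreal (k t y)))))"
    by (intro mult_left_mono wnorm_add_le q_pos w cmult_Mplus W K) simp
  also have "\<dots> = ennreal D * quasi q * (W t * H f t + K t * I f t)"
    unfolding wnorm_cmult[OF q_pos w W] wnorm_cmult[OF q_pos w K] by (simp only: mult_ac)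
  finally have "E f j epowr r \<le> (ennreal D * quasi q * (W t * H f t + K t * I f t)) epowr r"
    using r_pos by (intro epowr_mono) auto
  also have "\<dots> \<le> (ennreal D * quasi q) epowr r * (ennreal (2 powr r) * ((W t * H f t) epowr r + (K t * I f t) epowr r))"
    unfolding epowr_mult[of "ennreal D * quasi q"] using r_pos by (intro mult_left_mono epowr_add_le) auto
  finally show ?thesis by (simp only: cE_def mult.assoc)
qed

lemma cE_pos: "0 < cE" "cE < top"
proof -
  have "quasi q \<noteq> 0" "ennreal D \<noteq> 0" using D_ge by (auto simp: quasi_def)
  then show "0 < cE" by (auto simp: cE_def zero_less_iff_neq_zero)
  show "cE < top" by (auto simp: cE_def ennreal_mult_less_top)
qed

lemma sum_E_le:
  assumes f: "f \<in> Mplus" "N f < top"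
    and A0: "A0 p q r u v w k < top" and A1: "A1 p q r u v w k < top"
  shows "int_sum (\<lambda>j. ennreal (l j) * E f j epowr r) \<le>
    8 * cE * (A0 p q r u v w k epowr r + A1 p q r u v w k epowr r) * N f epowr r"
proof -
  note [measurable] = u H_Mplus[OF f(1)]
  \<comment> \<open>The step function with value \<open>E f j epowr r\<close> on block j + 1. It is
    the measurable minorant through which the integral of the sum of the \<open>W\<close> and
    \<open>K\<close> terms is split.\<close>
  define m where "m t = int_sum (\<lambda>j. indicator {x (j + 1)<..x (j + 1 + 1)} t * E f j epowr r)" for t
  \<comment> \<open>Enumerating the integers by \<open>int_decode\<close> turns m into a series
    indexed by the naturals.\<close>
  have m_meas [measurable]: "m \<in> borel_measurable HL"
    unfolding m_def[abs_def] nn_integral_bij_count_space[OF bij_int_decode, symmetric]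
      nn_integral_count_space_nat by measurable
  obtain c where c: "cE = ennreal c" "0 < c" using cE_pos by (cases cE) auto
  have cc: "ennreal c * ennreal (1 / c) = 1" "ennreal (1 / c) * ennreal c = 1"
    using c by (auto simp flip: ennreal_mult)
  have "mono W"
  proof (rule monoI)
    fix s t :: real assume "s \<le> t"
    then show "W s \<le> W t"
      using cut_Mplus[OF one_Mplus, of "{0<..s}"] by (intro wnorm_mono[OF q_pos w]) (auto split: split_indicator)
  qed
  then have [measurable]: "W \<in> borel_measurable HL" by (rule mono_on_measurable_HL)
  have m_le: "AE t in HL. ennreal (1 / c) * m t \<le> (W t * H f t) epowr r + (K t * I f t) epowr r"
    using AE_HL_pos
  proof eventually_elim
    case (elim t)
    obtain i where i: "x i < t" "t \<le> x (i + 1)" using cover[OF elim] .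
    have "m t = E f (i - 1) epowr r"
      unfolding m_def using i by (intro int_sum_block_shift) auto
    also have "\<dots> \<le> ennreal c * ((W t * H f t) epowr r + (K t * I f t) epowr r)"
      using E_le[OF f(1), of "i - 1" t] i c by simp
    finally have "ennreal (1 / c) * m t \<le> ennreal (1 / c) * (ennreal c * ((W t * H f t) epowr r + (K t * I f t) epowr r))"
      by (rule mult_left_mono) simp
    then show ?case by (simp only: mult.assoc[symmetric] cc mult_1)
  qed
  have "int_sum (\<lambda>j. ennreal (l j) * E f j epowr r) \<le> int_sum (\<lambda>j. 8 * (mass (j + 1) * E f j epowr r))"
  proof (rule nn_integral_mono)
    fix j
    show "ennreal (l j) * E f j epowr r \<le> 8 * (mass (j + 1) * E f j epowr r)"
    proof (cases "x (j + 1) = 0")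
      case True
      then show ?thesis unfolding B_empty[OF True] by simp
    next
      case False
      then have "0 < x (j + 1)" using x_nonneg[of "j + 1"] by linarith
      then have "0 < x (j + 1 + 1)" using x_mono[of "j + 1"] by linarith
      then have "ennreal (l (j + 1) / 4) \<le> mass (j + 1)" by (rule mass_ge)
      then have "8 * ennreal (l (j + 1) / 4) \<le> 8 * mass (j + 1)" by (rule mult_left_mono) simp
      moreover have "ennreal (l j) = 8 * ennreal (l (j + 1) / 4)"
      proof -
        have "l j = 8 * (l (j + 1) / 4)" by (simp add: l_Suc)
        then show ?thesis by (simp only: ennreal_mult' ennreal_numeral zero_le_numeral)
      qed
      ultimately have "ennreal (l j) * E f j epowr r \<le> 8 * mass (j + 1) * E f j epowr r"
        by (intro mult_right_mono) auto
      then show ?thesis by (simp only: mult.assoc)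
    qed
  qed
  also have "\<dots> = 8 * int_sum (\<lambda>j. mass (j + 1) * E f j epowr r)"
    by (rule nn_integral_cmult) simp
  also have "int_sum (\<lambda>j. mass (j + 1) * E f j epowr r)
    = int_sum (\<lambda>j. \<integral>\<^sup>+t. u t * (indicator {x (j + 1)<..x (j + 1 + 1)} t * E f j epowr r) \<partial>HL)"
    by (simp only: mass_def mult.assoc[symmetric]) (rule nn_integral_cong, rule nn_integral_multc[symmetric], measurable)
  also have "\<dots> = (\<integral>\<^sup>+t. int_sum (\<lambda>j. u t * (indicator {x (j + 1)<..x (j + 1 + 1)} t * E f j epowr r)) \<partial>HL)"
    by (rule nn_integral_count_space_nn_integral[symmetric]) auto
  also have "\<dots> = (\<integral>\<^sup>+t. u t * m t \<partial>HL)"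
    by (simp add: nn_integral_cmult m_def)
  also have "\<dots> = (\<integral>\<^sup>+t. ennreal c * (u t * (ennreal (1 / c) * m t)) \<partial>HL)"
    by (rule nn_integral_cong) (metis cc(1) mult.assoc mult.left_commute mult_1)
  also have "\<dots> = ennreal c * (\<integral>\<^sup>+t. u t * (ennreal (1 / c) * m t) \<partial>HL)"
    by (rule nn_integral_cmult) measurable
  also have "(\<integral>\<^sup>+t. u t * (ennreal (1 / c) * m t) \<partial>HL)
    \<le> (\<integral>\<^sup>+t. u t * (W t * H f t) epowr r \<partial>HL) + (\<integral>\<^sup>+t. u t * (K t * I f t) epowr r \<partial>HL)"
    by (rule nn_integral_le_add[OF _ _ _ m_le]) measurable
  also have "(\<integral>\<^sup>+t. u t * (W t * H f t) epowr r \<partial>HL) \<le> (A0 p q r u v w k * N f) epowr r"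
    using least_const_bound[OF A0[unfolded A0_eq] f] r_pos
    by (simp add: A0_eq epowr_le_swap epowr_mult mult.assoc)
  also have "(\<integral>\<^sup>+t. u t * (K t * I f t) epowr r \<partial>HL) \<le> (A1 p q r u v w k * N f) epowr r"
    using least_const_bound[OF A1[unfolded A1_eq] f] r_pos
    by (simp add: A1_eq epowr_le_swap epowr_mult mult.assoc)
  finally show ?thesis
    by (simp add: c(1) epowr_mult distrib_right mult.assoc mult_left_mono add_mono)
qed

section \<open>The near part\<close>

abbreviation Q :: "int \<Rightarrow> ennreal" where
  "Q j \<equiv> least_const (ennreal p) v (\<lambda>g. P g j)"

abbreviation F :: "(real \<Rightarrow> ennreal) \<Rightarrow> int \<Rightarrow> ennreal" where
  "F f j \<equiv> N (\<lambda>z. indicator {x j<..x (j + 2)} z * f z)"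

lemma Q_empty:
  assumes "x (j + 1) = 0"
  shows "Q j = 0"
proof -
  have "Q j \<le> 0"
    by (rule least_const_le) (simp only: B_empty[OF assms] zero_le)
  then show ?thesis by simp
qed

lemma F_le:
  assumes "f \<in> Mplus"
  shows "F f j \<le> N f"
  by (rule wnorm_mono) (use p_pos v assms in \<open>auto intro!: cut_Mplus split: split_indicator\<close>)

text \<open>For y in block j only arguments z \<ge> y > \<open>x j\<close> matter, and the near part
  stops at \<open>x (j + 2)\<close>; so f may be replaced by its restriction. This localisation is
  what makes the estimates summable over j.\<close>

lemma P_le:
  assumes f: "f \<in> Mplus" "N f < top" and Q: "Q j < top"
  shows "P f j \<le> Q j * F f j"
proof -
  let ?g = "\<lambda>z. indicator {x j<..x (j + 2)} z * f z"
  have g: "?g \<in> Mplus" by (rule cut_Mplus[OF f(1)]) simp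
  have "P f j \<le> P ?g j"
  proof (rule wnorm_mono[OF q_pos w cut_H_Mplus[OF f12_Mplus(1)[OF f(1)]]])
    fix y :: real assume y: "0 < y"
    show "indicator (J j) y * H (f1 f j) y \<le> indicator (J j) y * H (f1 ?g j) y"
    proof (cases "y \<in> J j")
      case True
      then have "H (f1 f j) y \<le> H (f1 ?g j) y"
        using y by (intro H_op_mono) (auto split: split_indicator)
      then show ?thesis using True by simp
    qed simp
  qed
  also have "\<dots> \<le> Q j * N ?g"
    by (rule least_const_bound[OF Q g]) (use F_le[OF f(1)] f(2) in \<open>rule le_less_trans\<close>)
  finally show ?thesis .
qed

text \<open>The factor 2 counts overlaps: the interval with index j consists of the blocks j and j +
  1, so each point lies in two of them.\<close>

lemma sum_F_le:
  assumes f: "f \<in> Mplus"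
  shows "int_sum (\<lambda>j. F f j epowr p) \<le> 2 * N f epowr p"
proof -
  note [measurable] = f v
  let ?h = "\<lambda>z. f z epowr p * v z"
  have "int_sum (\<lambda>j. F f j epowr p) = int_sum (\<lambda>j. \<integral>\<^sup>+z. (indicator {x j<..x (j + 2)} z * f z) epowr p * v z \<partial>HL)"
    by (simp add: wnorm_epowr p_pos)
  also have "\<dots> = (\<integral>\<^sup>+z. int_sum (\<lambda>j. (indicator {x j<..x (j + 2)} z * f z) epowr p * v z) \<partial>HL)"
    by (rule nn_integral_count_space_nn_integral[symmetric]) auto
  also have "\<dots> \<le> (\<integral>\<^sup>+z. 2 * ?h z \<partial>HL)"
  proof (rule nn_integral_mono_AE, use AE_HL_pos in eventually_elim)
    case (elim z)
    obtain i where i: "x i < z" "z \<le> x (i + 1)" using cover[OF elim] .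
    have "int_sum (\<lambda>j. (indicator {x j<..x (j + 2)} z * f z) epowr p * v z)
      \<le> int_sum (\<lambda>j. indicator (J j) z * ?h z + indicator {x (j + 1)<..x (j + 1 + 1)} z * ?h z)"
    proof (rule nn_integral_mono)
      fix j
      have "x (j + 2) = x (j + 1 + 1)" by (simp add: add.assoc)
      then show "(indicator {x j<..x (j + 2)} z * f z) epowr p * v z
        \<le> indicator (J j) z * ?h z + indicator {x (j + 1)<..x (j + 1 + 1)} z * ?h z"
        by (auto split: split_indicator)
    qed
    also have "\<dots> = int_sum (\<lambda>j. indicator (J j) z * ?h z) + int_sum (\<lambda>j. indicator {x (j + 1)<..x (j + 1 + 1)} z * ?h z)"
      by (rule nn_integral_add) auto
    also have "\<dots> = ?h z + ?h z"
      using int_sum_block[OF i, of "\<lambda>_. ?h z"] int_sum_block_shift[of "i - 1" 1 z "\<lambda>_. ?h z"] i by simp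
    finally show ?case by (simp add: mult_2)
  qed
  also have "\<dots> = 2 * N f epowr p" by (simp add: nn_integral_cmult wnorm_epowr p_pos)
  finally show ?thesis .
qed

definition c_less :: ennreal where
  "c_less = 2 * 2 epowr (r / p)"

definition c_greater :: ennreal where
  "c_greater = (let s = s_exp p r in 2 * (ennreal (4 * 2 powr (s / p)) epowr (r / s) * 2 epowr (r / p)))"

text \<open>\<open>Q j\<close> is at most the norm of the cut at \<open>x (j + 1)\<close>, where the
  tail equals \<open>l (j + 1) = l j / 2\<close>; this bounds \<open>l j\<close> times the power of
  \<open>Q j\<close> uniformly and gives the factor 2 in \<open>c_less\<close>. Its second factor
  comes from the overlaps in \<open>sum_F_le\<close>.\<close>

lemma sum_P_le_1:
  assumes f: "f \<in> Mplus" "N f < top" and pr: "p \<le> r" and A2: "A2 p q r u v w k < top"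
  shows "int_sum (\<lambda>j. ennreal (l j) * P f j epowr r) \<le> c_less * A2 p q r u v w k epowr r * N f epowr r"
proof -
  let ?A = "A2 p q r u v w k"
  have Q_le: "ennreal (l j) * Q j epowr r \<le> 2 * ?A epowr r" for j
  proof (cases "x (j + 1) = 0")
    case True
    then show ?thesis unfolding Q_empty[OF True] by simp
  next
    case False
    then have x: "0 < x (j + 1)" using x_nonneg[of "j + 1"] by linarith
    have "Q j \<le> M (x (j + 1))"
      unfolding M_eq
    proof (rule least_const_mono)
      fix g assume g: "g \<in> Mplus"
      show "P g j \<le> T g (x (j + 1))"
      proof (rule wnorm_mono[OF q_pos w cut_H_Mplus[OF f12_Mplus(1)[OF g]]])
        fix y :: real assume "0 < y"
        then show "indicator (J j) y * H (f1 g j) y \<le> indicator {0<..x (j + 1)} y * H g y"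
          by (intro mult_mono H_op_mono) (auto split: split_indicator)
      qed
    qed
    then have "tail u (x (j + 1)) epowr (1 / r) * Q j \<le> tail u (x (j + 1)) epowr (1 / r) * M (x (j + 1))"
      by (rule mult_left_mono) simp
    also have "\<dots> \<le> ?A" using pr x by (auto simp: A2_def intro!: SUP_upper2[of "x (j + 1)"])
    finally have "(tail u (x (j + 1)) epowr (1 / r) * Q j) epowr r \<le> ?A epowr r"
      using r_pos by (intro epowr_mono) auto
    then have "ennreal (l (j + 1)) * Q j epowr r \<le> ?A epowr r"
      using r_pos by (simp add: epowr_mult epowr_inverse tail_x[OF x])
    then have "2 * (ennreal (l (j + 1)) * Q j epowr r) \<le> 2 * ?A epowr r" by (rule mult_left_mono) simp
    moreover have "ennreal (l j) = 2 * ennreal (l (j + 1))"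
    proof -
      have "l j = 2 * l (j + 1)" by (simp add: l_Suc)
      then show ?thesis by (simp only: ennreal_mult' ennreal_numeral zero_le_numeral)
    qed
    ultimately show ?thesis by (simp only: mult.assoc)
  qed
  have Q_fin: "Q j < top" for j
  proof -
    have "ennreal (l j) * Q j epowr r < top"
      by (rule le_less_trans[OF Q_le]) (use A2 in \<open>simp add: ennreal_mult_less_top\<close>)
    moreover have "ennreal (l j) \<noteq> 0" using l_pos[of j] by (simp add: ennreal_eq_0_iff not_le)
    ultimately show ?thesis by (cases "Q j") (auto simp: ennreal_mult_top)
  qed
  have "int_sum (\<lambda>j. ennreal (l j) * P f j epowr r) \<le> int_sum (\<lambda>j. 2 * ?A epowr r * F f j epowr r)"
  proof (rule nn_integral_mono)
    fix j
    have "P f j epowr r \<le> (Q j * F f j) epowr r"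
      using r_pos by (intro epowr_mono P_le f Q_fin) auto
    then have "ennreal (l j) * P f j epowr r \<le> ennreal (l j) * Q j epowr r * F f j epowr r"
      unfolding epowr_mult mult.assoc by (rule mult_left_mono) simp
    also have "\<dots> \<le> 2 * ?A epowr r * F f j epowr r" by (rule mult_right_mono[OF Q_le]) simp
    finally show "ennreal (l j) * P f j epowr r \<le> 2 * ?A epowr r * F f j epowr r" .
  qed
  also have "\<dots> = 2 * ?A epowr r * int_sum (\<lambda>j. (F f j epowr p) epowr (r / p))"
    using p_pos by (simp add: nn_integral_cmult epowr_epowr)
  also have "\<dots> \<le> 2 * ?A epowr r * int_sum (\<lambda>j. F f j epowr p) epowr (r / p)"
    using pr p_pos by (intro mult_left_mono int_sum_epowr_le) auto
  also have "\<dots> \<le> 2 * ?A epowr r * (2 * N f epowr p) epowr (r / p)"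
    using r_pos p_pos by (intro mult_left_mono epowr_mono sum_F_le f) auto
  also have "\<dots> = c_less * ?A epowr r * N f epowr r"
    using p_pos by (simp add: c_less_def epowr_mult epowr_epowr mult_ac)
  finally show ?thesis .
qed

text \<open>The counterpart of \<open>block_norm_le_M\<close>: by \<open>zeta_bounds\<close> the
  block operator at t sees all of block j and integrates at least up to
  \<open>x (j + 2)\<close>.\<close>

lemma Q_le_block_norm:
  assumes t: "x j < t" "t \<le> x (j + 1)"
  shows "Q j \<le> op_norm (ennreal p) v q w (H_block k u (zeta_inv u t) (zeta u t))"
  unfolding op_norm_def
proof (rule least_const_mono)
  fix g assume g: "g \<in> Mplus"
  show "P g j \<le> Phi (H_block k u (zeta_inv u t) (zeta u t) g)"
  proof (rule wnorm_mono[OF q_pos w cut_H_Mplus[OF f12_Mplus(1)[OF g]]])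
    fix y :: real assume "0 < y"
    then show "indicator (J j) y * H (f1 g j) y \<le> H_block k u (zeta_inv u t) (zeta u t) g y"
      unfolding H_block_eq using zeta_bounds[OF t]
      by (intro mult_mono H_op_mono) (auto split: split_indicator)
  qed
qed

text \<open>The constant 4 is the loss in \<open>mass_ge\<close>; on block j the tail is bounded
  below only by \<open>l (j + 1) = l j / 2\<close>, which costs 2^(s/p).\<close>

lemma sum_Q_le:
  assumes rp: "r < p"
  defines "s \<equiv> s_exp p r"
  shows "int_sum (\<lambda>j. ennreal (l j) epowr (s / r) * Q j epowr s)
    \<le> ennreal (4 * 2 powr (s / p)) * A2 p q r u v w k epowr s"
proof -
  have s: "1 / s = 1 / r - 1 / p" "0 < s" using s_exp_props[OF rp] by (auto simp: s_def)
  have exps: "s / p + 1 = s / r" using s r_pos p_pos by (auto simp: field_simps)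
  note [measurable] = u
  let ?Bl = "\<lambda>t. op_norm (ennreal p) v q w (H_block k u (zeta_inv u t) (zeta u t))"
  let ?c = "\<lambda>j. ennreal (l (j + 1)) epowr (s / p) * Q j epowr s"
  have l_le: "ennreal (l j) epowr (s / r) * Q j epowr s \<le> ennreal (4 * 2 powr (s / p)) * (mass j * ?c j)" for j
  proof (cases "x (j + 1) = 0")
    case True
    then show ?thesis unfolding Q_empty[OF True] by simp
  next
    case False
    then have x: "0 < x (j + 1)" using x_nonneg[of "j + 1"] by linarith
    have "l j powr (s / r) = l j powr (s / p) * l j"
      using l_pos[of j] powr_add[of "l j" "s / p" 1] exps by (simp add: less_imp_le)
    also have "l j powr (s / p) = 2 powr (s / p) * l (j + 1) powr (s / p)"
      using powr_mult[of 2 "l (j + 1)" "s / p"] by (simp add: l_Suc)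
    finally have "ennreal (l j) epowr (s / r) = ennreal (4 * 2 powr (s / p)) * (ennreal (l j / 4) * ennreal (l (j + 1)) epowr (s / p))"
      by (simp add: less_imp_le flip: ennreal_mult)
    then have "ennreal (l j) epowr (s / r) * Q j epowr s = ennreal (4 * 2 powr (s / p)) * (ennreal (l j / 4) * ?c j)"
      by (simp only: mult.assoc)
    also have "\<dots> \<le> ennreal (4 * 2 powr (s / p)) * (mass j * ?c j)"
      by (intro mult_left_mono mult_right_mono mass_ge x) auto
    finally show ?thesis .
  qed
  have "int_sum (\<lambda>j. ennreal (l j) epowr (s / r) * Q j epowr s)
    \<le> int_sum (\<lambda>j. ennreal (4 * 2 powr (s / p)) * (mass j * ?c j))"
    by (rule nn_integral_mono) (rule l_le)
  also have "\<dots> = ennreal (4 * 2 powr (s / p)) * int_sum (\<lambda>j. mass j * ?c j)"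
    by (rule nn_integral_cmult) simp
  also have "int_sum (\<lambda>j. mass j * ?c j) = int_sum (\<lambda>j. \<integral>\<^sup>+t. u t * indicator (J j) t * ?c j \<partial>HL)"
    by (simp add: nn_integral_multc mass_def)
  also have "\<dots> = (\<integral>\<^sup>+t. int_sum (\<lambda>j. u t * indicator (J j) t * ?c j) \<partial>HL)"
    by (rule nn_integral_count_space_nn_integral[symmetric]) auto
  also have "\<dots> \<le> (\<integral>\<^sup>+t. u t * tail u t epowr (s / p) * ?Bl t epowr s \<partial>HL)"
  proof (rule nn_integral_mono_AE, use AE_HL_pos in eventually_elim)
    case (elim t)
    obtain i where i: "x i < t" "t \<le> x (i + 1)" using cover[OF elim] .
    have "int_sum (\<lambda>j. u t * indicator (J j) t * ?c j) = u t * ?c i"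
      using int_sum_block[OF i, of ?c] by (simp add: mult.assoc nn_integral_cmult)
    also have "\<dots> \<le> u t * (tail u t epowr (s / p) * ?Bl t epowr s)"
      using s(2) p_pos by (intro mult_left_mono mult_mono epowr_mono tail_block(1)[OF i] Q_le_block_norm[OF i]) auto
    finally show ?case by (simp add: mult.assoc)
  qed
  also have "\<dots> = A2 p q r u v w k epowr s"
    using rp s(2) by (simp add: A2_def set_nn_integral_HL epowr_inverse flip: s_def)
  finally show ?thesis by (simp add: mult_left_mono)
qed

lemma sum_P_le_2:
  assumes f: "f \<in> Mplus" "N f < top" and rp: "r < p" and A2: "A2 p q r u v w k < top"
  shows "int_sum (\<lambda>j. ennreal (l j) * P f j epowr r) \<le> c_greater * A2 p q r u v w k epowr r * N f epowr r"
proof -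
  let ?A = "A2 p q r u v w k"
  define s where "s = s_exp p r"
  have s: "1 / s = 1 / r - 1 / p" "0 < s" using s_exp_props[OF rp] by (auto simp: s_def)
  have exps: "1 / (s / r) + 1 / (p / r) = 1" "1 < s / r" "1 < p / r"
  proof -
    have "r / s = 1 - r / p" using s(1) r_pos by (simp add: field_simps)
    moreover have "0 < r / p" using r_pos p_pos by simp
    ultimately have "r / s < 1" "1 / (s / r) + 1 / (p / r) = 1" by simp_all
    then show "1 / (s / r) + 1 / (p / r) = 1" "1 < s / r" "1 < p / r" using s(2) r_pos rp by simp_all
  qed
  let ?c = "ennreal (4 * 2 powr (s / p))"
  have sumQ: "int_sum (\<lambda>j. ennreal (l j) epowr (s / r) * Q j epowr s) \<le> ?c * ?A epowr s"
    unfolding s_def by (rule sum_Q_le[OF rp])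
  have Q_fin: "Q j < top" for j
  proof -
    have "ennreal (l j) epowr (s / r) * Q j epowr s \<le> ?c * ?A epowr s"
      using int_sum_upper[of "\<lambda>j. ennreal (l j) epowr (s / r) * Q j epowr s" j] sumQ by (rule order_trans)
    also have "\<dots> < top" using A2 by (simp add: ennreal_mult_less_top)
    finally have "ennreal (l j) epowr (s / r) * Q j epowr s < top" .
    moreover have "ennreal (l j) epowr (s / r) \<noteq> 0"
      using l_pos[of j] by (simp add: ennreal_eq_0_iff not_le del: epowr_ennreal)
    ultimately show ?thesis by (cases "Q j") (auto simp: ennreal_mult_top simp del: epowr_ennreal)
  qed
  have "int_sum (\<lambda>j. ennreal (l j) * P f j epowr r)
    \<le> int_sum (\<lambda>j. (ennreal (l j) * Q j epowr r) * F f j epowr r)"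
  proof (rule nn_integral_mono)
    fix j
    have "P f j epowr r \<le> (Q j * F f j) epowr r"
      using r_pos by (intro epowr_mono P_le f Q_fin) auto
    then show "ennreal (l j) * P f j epowr r \<le> (ennreal (l j) * Q j epowr r) * F f j epowr r"
      unfolding epowr_mult mult.assoc by (rule mult_left_mono) simp
  qed
  \<comment> \<open>Hoelder's inequality on the integers; s / r and p / r are conjugate because r /
    s + r / p = 1.\<close>
  also have "\<dots> \<le> 2 * (int_sum (\<lambda>j. (ennreal (l j) * Q j epowr r) epowr (s / r)) epowr (1 / (s / r))
      * int_sum (\<lambda>j. (F f j epowr r) epowr (p / r)) epowr (1 / (p / r)))"
    by (rule nn_integral_holder) (use exps in auto)
  also have "\<dots> = 2 * (int_sum (\<lambda>j. ennreal (l j) epowr (s / r) * Q j epowr s) epowr (r / s)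
      * int_sum (\<lambda>j. F f j epowr p) epowr (r / p))"
    using r_pos by (simp add: epowr_mult epowr_epowr)
  also have "\<dots> \<le> 2 * ((?c * ?A epowr s) epowr (r / s) * (2 * N f epowr p) epowr (r / p))"
    using r_pos p_pos s(2) by (intro mult_left_mono mult_mono epowr_mono sumQ sum_F_le f) auto
  also have "\<dots> = c_greater * ?A epowr r * N f epowr r"
    using p_pos s(2) unfolding c_greater_def Let_def s_def[symmetric]
    by (simp only: epowr_mult epowr_epowr) (simp add: mult_ac)
  finally show ?thesis .
qed

section \<open>Collecting the constants\<close>

definition c_upper :: ennreal where
  "c_upper = block_const q (1 / (2 * r)) epowr r * geom (1 / 2) * (quasi q epowr r * ennreal (2 powr r))
     * (8 * cE + (if p \<le> r then c_less else c_greater))"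

lemma LT_upper:
  assumes f: "f \<in> Mplus" "N f < top"
    and A0: "A0 p q r u v w k < top" and A1: "A1 p q r u v w k < top" and A2: "A2 p q r u v w k < top"
  shows "LT f \<le> (3 * c_upper) epowr (1 / r) * (A0 p q r u v w k + A1 p q r u v w k + A2 p q r u v w k) * N f"
proof -
  let ?A0 = "A0 p q r u v w k" and ?A1 = "A1 p q r u v w k" and ?A2 = "A2 p q r u v w k"
  let ?S = "?A0 + ?A1 + ?A2"
  let ?cp = "if p \<le> r then c_less else c_greater"
  let ?b = "block_const q (1 / (2 * r)) epowr r * geom (1 / 2)" and ?q = "quasi q epowr r * ennreal (2 powr r)"
  have sumP: "int_sum (\<lambda>j. ennreal (l j) * P f j epowr r) \<le> ?cp * ?A2 epowr r * N f epowr r"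
    using sum_P_le_1[OF f _ A2] sum_P_le_2[OF f _ A2] by auto
  note sumE = sum_E_le[OF f A0 A1]
  have "int_sum (\<lambda>j. ennreal (l j) * B f j epowr r)
    \<le> int_sum (\<lambda>j. ?q * (ennreal (l j) * P f j epowr r + ennreal (l j) * E f j epowr r))"
  proof (rule nn_integral_mono)
    fix j
    have "ennreal (l j) * B f j epowr r \<le> ennreal (l j) * (?q * (P f j epowr r + E f j epowr r))"
      by (intro mult_left_mono B_le f) simp
    then show "ennreal (l j) * B f j epowr r \<le> ?q * (ennreal (l j) * P f j epowr r + ennreal (l j) * E f j epowr r)"
      by (simp only: distrib_left mult_ac)
  qed
  also have "\<dots> = ?q * (int_sum (\<lambda>j. ennreal (l j) * P f j epowr r) + int_sum (\<lambda>j. ennreal (l j) * E f j epowr r))"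
    by (subst nn_integral_cmult, simp, subst nn_integral_add) simp_all
  also have "\<dots> \<le> ?q * (?cp * ?A2 epowr r * N f epowr r + 8 * cE * (?A0 epowr r + ?A1 epowr r) * N f epowr r)"
    by (intro mult_left_mono add_mono sumP sumE) simp
  \<comment> \<open>Each of the three constants is at most their sum S. The common factor 3 gives
    both groups the same multiple of a power of S, so that they can be added.\<close>
  also have "\<dots> \<le> ?q * (?cp * (3 * ?S epowr r) * N f epowr r + 8 * cE * (3 * ?S epowr r) * N f epowr r)"
  proof (intro mult_left_mono add_mono mult_right_mono)
    have S: "?A0 epowr r \<le> ?S epowr r" "?A1 epowr r \<le> ?S epowr r" "?A2 epowr r \<le> ?S epowr r"
      using r_pos by (auto intro!: epowr_mono simp: add_increasing add_increasing2)
    then show "?A2 epowr r \<le> 3 * ?S epowr r"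
      using mult_right_mono[of 1 3 "?S epowr r"] by (auto intro: order_trans)
    have "?A0 epowr r + ?A1 epowr r \<le> 2 * ?S epowr r" using S by (simp add: mult_2 add_mono)
    also have "\<dots> \<le> 3 * ?S epowr r" by (rule mult_right_mono) auto
    finally show "?A0 epowr r + ?A1 epowr r \<le> 3 * ?S epowr r" .
  qed auto
  also have "\<dots> = ?q * (8 * cE + ?cp) * (3 * (?S epowr r * N f epowr r))"
    by (simp only: distrib_left distrib_right mult_ac add.commute)
  finally have sumB: "int_sum (\<lambda>j. ennreal (l j) * B f j epowr r) \<le> ?q * (8 * cE + ?cp) * (3 * (?S epowr r * N f epowr r))" .
  have "(\<integral>\<^sup>+t. u t * T f t epowr r \<partial>HL) \<le> ?b * int_sum (\<lambda>j. ennreal (l j) * B f j epowr r)"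
    by (rule LT_le_blocks[OF f(1)])
  also have "\<dots> \<le> ?b * (?q * (8 * cE + ?cp) * (3 * (?S epowr r * N f epowr r)))"
    by (intro mult_left_mono sumB) simp
  also have "\<dots> = 3 * c_upper * (?S * N f) epowr r"
    unfolding c_upper_def epowr_mult by (simp only: mult_ac)
  finally have "LT f \<le> (3 * c_upper * (?S * N f) epowr r) epowr (1 / r)"
    using r_pos by (intro epowr_mono) auto
  also have "\<dots> = (3 * c_upper) epowr (1 / r) * ?S * N f"
    using r_pos by (subst epowr_mult) (simp add: epowr_inverse mult.assoc)
  finally show ?thesis .
qed

lemma c_upper_less_top: "c_upper < top"
proof -
  have "block_const q (1 / (2 * r)) < top" using r_pos by (intro block_const_less_top q_pos) simp
  moreover have "geom (1 / 2) < top" by (rule geom_less_top) simp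
  moreover have "c_less < top" "c_greater < top"
    by (auto simp: c_less_def c_greater_def Let_def ennreal_mult_less_top)
  ultimately show ?thesis
    using cE_pos by (auto simp: c_upper_def ennreal_mult_less_top)
qed

lemma CT_le:
  assumes "A0 p q r u v w k < top" "A1 p q r u v w k < top" "A2 p q r u v w k < top"
  shows "CT \<le> (3 * c_upper) epowr (1 / r) * (A0 p q r u v w k + A1 p q r u v w k + A2 p q r u v w k)"
  unfolding CT_eq by (rule least_const_le) (rule LT_upper[OF _ _ assms])

text \<open>The bracket adds the bounds for \<open>A2\<close> in both regimes, 1 for p \<le> r and
  the root for r < p, so that one constant serves both.\<close>

lemma A_sum_le:
  assumes "CT < top"
  shows "A0 p q r u v w k + A1 p q r u v w k + A2 p q r u v w k
    \<le> (2 * ennreal D + 1 + ennreal (16 * 2 powr r) epowr (1 / r)) * CT"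
proof -
  have "A2 p q r u v w k \<le> (1 + ennreal (16 * 2 powr r) epowr (1 / r)) * CT"
    using A2_le_1[OF assms] A2_le_2[OF assms]
    by (cases "p \<le> r") (auto simp: distrib_right intro: add_increasing add_increasing2)
  then have "A0 p q r u v w k + A1 p q r u v w k + A2 p q r u v w k
    \<le> ennreal D * CT + ennreal D * CT + (1 + ennreal (16 * 2 powr r) epowr (1 / r)) * CT"
    by (intro add_mono A0_le A1_le assms)
  then show ?thesis by (simp only: mult_2 distrib_right add.assoc)
qed

end

theorem theorem3p1:
  fixes p r D :: real and q :: ennreal
  assumes "1 \<le> p" and "0 < r" and "0 < q" and "1 \<le> D"
  shows "\<exists>c1::real. \<exists>c2::real. c1 > 0 \<and> c2 > 0 \<and>
    (\<forall>u v w :: real \<Rightarrow> ennreal. \<forall>k :: real \<Rightarrow> real \<Rightarrow> real.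
      u \<in> Mplus \<longrightarrow> v \<in> Mplus \<longrightarrow> w \<in> Mplus \<longrightarrow>
      (\<forall>t>0. 0 < tail u t \<and> tail u t < top) \<longrightarrow>
      oinarov_kernel D k \<longrightarrow>
      (C_T p q r u v w k < top \<longleftrightarrow>
         A0 p q r u v w k < top \<and> A1 p q r u v w k < top \<and> A2 p q r u v w k < top) \<and>
      C_T p q r u v w k
        \<le> ennreal c1 * (A0 p q r u v w k + A1 p q r u v w k + A2 p q r u v w k) \<and>
      A0 p q r u v w k + A1 p q r u v w k + A2 p q r u v w k
        \<le> ennreal c2 * C_T p q r u v w k)"
proof -
  \<comment> \<open>Outside the locale \<open>c_upper\<close> takes only p, r, D and q as
    parameters, neither u nor its levels, so the constants can be fixed before the functions
    are.\<close>
  define X1 where "X1 = (3 * iterated.c_upper p r D q) epowr (1 / r)"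
  define X2 where "X2 = 2 * ennreal D + 1 + ennreal (16 * 2 powr r) epowr (1 / r)"
  \<comment> \<open>Adding 1 secures positivity, which is used when the quantity on the right of an
    inequality is infinite.\<close>
  define c1 where "c1 = enn2real X1 + 1"
  define c2 where "c2 = enn2real X2 + 1"
  have le: "X \<le> ennreal (enn2real X + 1)" if "X < top" for X
    using that by (cases X) auto
  have c_pos: "0 < c1" "0 < c2" by (simp_all add: c1_def c2_def add_nonneg_pos)
  show ?thesis
  proof (rule exI[of _ c1], rule exI[of _ c2], intro conjI allI impI)
    show "0 < c1" "0 < c2" by (fact c_pos)+
    fix u v w :: "real \<Rightarrow> ennreal" and k :: "real \<Rightarrow> real \<Rightarrow> real"
    assume hyps: "u \<in> Mplus" "v \<in> Mplus" "w \<in> Mplus" "\<forall>t>0. 0 < tail u t \<and> tail u t < top" "oinarov_kernel D k"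
    obtain x L where "levels u x L" using levels_exist[OF hyps(1)] hyps(4) by blast
    then interpret iterated u x L p r D q v w k
      using assms hyps by (auto intro!: iterated.intro iterated_axioms.intro)
    let ?S = "A0 p q r u v w k + A1 p q r u v w k + A2 p q r u v w k"
    have "X1 < top" using c_upper_less_top by (simp add: X1_def ennreal_mult_less_top)
    then have X1: "X1 \<le> ennreal c1" unfolding c1_def by (rule le)
    have "X2 < top" by (simp add: X2_def ennreal_mult_less_top)
    then have X2: "X2 \<le> ennreal c2" unfolding c2_def by (rule le)
    show upper: "CT \<le> ennreal c1 * ?S"
    proof (cases "?S < top")
      case True
      then have "CT \<le> X1 * ?S" unfolding X1_def by (intro CT_le) auto
      also have "\<dots> \<le> ennreal c1 * ?S" by (rule mult_right_mono[OF X1]) simp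
      finally show ?thesis .
    next
      case False
      then have "?S = top" by (simp only: less_top[symmetric] not_not)
      then show ?thesis using c_pos by (simp only: ennreal_mult_top) simp
    qed
    show lower: "?S \<le> ennreal c2 * CT"
    proof (cases "CT < top")
      case True
      then have "?S \<le> X2 * CT" unfolding X2_def by (rule A_sum_le)
      also have "\<dots> \<le> ennreal c2 * CT" by (rule mult_right_mono[OF X2]) simp
      finally show ?thesis .
    next
      case False
      then have "CT = top" by (simp only: less_top[symmetric] not_not)
      then show ?thesis using c_pos by (simp only: ennreal_mult_top) simp
    qed
    show "CT < top \<longleftrightarrow> A0 p q r u v w k < top \<and> A1 p q r u v w k < top \<and> A2 p q r u v w k < top"
    proof
      assume "CT < top"
      then have "?S < top" by (intro le_less_trans[OF lower]) (simp add: ennreal_mult_less_top)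
      then show "A0 p q r u v w k < top \<and> A1 p q r u v w k < top \<and> A2 p q r u v w k < top" by simp
    next
      assume "A0 p q r u v w k < top \<and> A1 p q r u v w k < top \<and> A2 p q r u v w k < top"
      then show "CT < top" by (intro le_less_trans[OF upper]) (simp add: ennreal_mult_less_top)
    qed
  qed
qed

end
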